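(* Let $\mathcal{G}$ be a compact, connected metric graph of total length $|\mathcal{G}|$, equipped with Dirichlet conditions on a nonempty subset $\mathcal{V}_D$ of its vertices. Fix $\alpha \in (0,1)$. Then $$T_{\alpha}(\mathcal{G}) \;\le\; T_\alpha(\mathcal{I})=\frac{8\cdot 2^{2\alpha}\,|\mathcal{G}|^{2\alpha+1}}{\pi^{2+2\alpha}} \left(1 - 2^{-(2+2\alpha)}\right)\zeta(2+2\alpha),$$ where $\mathcal{I}$ is the interval graph $[0,|\mathcal{G}|]$ endowed with a Dirichlet condition at one endpoint and a Neumann condition at the other, and $\zeta(s)=\sum_{n\ge1}n^{-s}$ is the Riemann zeta function.
   Context: A compact metric graph $\mathcal{G}$ is obtained from a finite graph with vertex set $\mathcal{V}$ and edge set $\mathcal{E}$ (loops and parallel edges allowed) by identifying each edge $e$ with an interval $[0,\ell_e]$, $0<\ell_e<\infty$, and gluing endpoints according to the graph structure. Its total length is $|\mathcal{G}|=\sum_{e}\ell_e$. A nonempty set $\mathcal{V}_D\subseteq\mathcal{V}$ of Dirichlet vertices is fixed. $L^2(\mathcal{G})=\bigoplus_{e}L^2(0,\ell_e)$ with inner product $\langle\cdot,\cdot\rangle$. The Laplacian $-\Delta_{\mathcal{G}}$ acts as $-f_e''$ on each edge, with domain the edgewise $H^2$ functions that are continuous at every vertex, vanish at every $v\in\mathcal{V}_D$, and at every $v\in\mathcal{V}\setminus\mathcal{V}_D$ satisfy the Kirchhoff condition: the sum, over all edge ends incident to $v$, of the derivatives at $v$ taken in the direction pointing into $v$, is zero (at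 a vertex of degree one this is the Neumann condition). It is self-adjoint with compact resolvent, with eigenvalues $0<\lambda_1\le\lambda_2\le\cdots\to\infty$ (with multiplicity) and an $L^2$-orthonormal basis of eigenfunctions $\varphi_n$. For $\alpha\in(0,1)$, $(-\Delta_{\mathcal{G}})^\alpha f=\sum_n\lambda_n^\alpha\langle f,\varphi_n\rangle\varphi_n$ on the domain $\{f\in L^2(\mathcal{G}):\sum_n\lambda_n^{2\alpha}|\langle f,\varphi_n\rangle|^2<\infty\}$. The fractional torsion function $u_\alpha$ is the unique solution of $(-\Delta_{\mathcal{G}})^\alpha u_\alpha=1$, i.e. $u_\alpha=\sum_n\lambda_n^{-\alpha}\langle 1,\varphi_n\rangle\varphi_n$, and the fractional torsional rigidity is $T_\alpha(\mathcal{G})=\int_{\mathcal{G}}u_\alpha\,dx=\sum_n\lambda_n^{-\alpha}|\langle1,\varphi_n\rangle|^2$. *)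

theory Defs
  imports "HOL-Analysis.Analysis" "Graph_Theory.Graph_Theory"
begin

section \<open>Metric graphs\<close>

text \<open>
  The combinatorial graph is a \<open>pre_digraph\<close> (loops and parallel edges allowed); the orientation
  of an edge only serves to identify it with \<open>{0..len e}\<close>, where \<open>0\<close> is glued to \<open>tail\<close> and
  \<open>len e\<close> to \<open>head\<close>.
\<close>

record ('v, 'e) metric_graph =
  underlying :: "('v, 'e) pre_digraph"
  len :: "'e \<Rightarrow> real"
  dirichlet_verts :: "'v set"

definition compact_metric_graph :: "('v, 'e) metric_graph \<Rightarrow> bool" where
  "compact_metric_graph G \<longleftrightarrow>
     fin_digraph (underlying G) \<and>
     (\<forall>e\<in>arcs (underlying G). 0 < len G e) \<and>
     dirichlet_verts G \<subseteq> verts (underlying G)"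

text \<open>
  \<open>Digraph_Component.connected\<close> is connectedness of the undirected graph; the qualified name
  distinguishes it from topological connectedness.
\<close>

definition connected_metric_graph :: "('v, 'e) metric_graph \<Rightarrow> bool" where
  "connected_metric_graph G \<longleftrightarrow> Digraph_Component.connected (underlying G)"

definition total_length :: "('v, 'e) metric_graph \<Rightarrow> real" where
  "total_length G = (\<Sum>e\<in>arcs (underlying G). len G e)"

definition interval_graph :: "real \<Rightarrow> (nat, unit) metric_graph" where
  "interval_graph L =
     \<lparr>underlying = \<lparr>verts = {0, 1}, arcs = {()}, tail = (\<lambda>_. 0), head = (\<lambda>_. 1)\<rparr>,
      len = (\<lambda>_. L), dirichlet_verts = {0}\<rparr>"


section \<open>Square-integrable functions\<close>

text \<open>
  A function on the graph is given by its components \<open>f e\<close> on the edges; only the values on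
  \<open>{0..len e}\<close>, for \<open>e\<close> an edge, matter. Elements of \<open>L2\<close> are not quotiented by
  a.e.-equality.
\<close>

definition graph_integral :: "('v, 'e) metric_graph \<Rightarrow> ('e \<Rightarrow> real \<Rightarrow> real) \<Rightarrow> real" where
  "graph_integral G f = (\<Sum>e\<in>arcs (underlying G). integral\<^sup>L (lebesgue_on {0..len G e}) (f e))"

definition L2_interval :: "real \<Rightarrow> (real \<Rightarrow> real) \<Rightarrow> bool" where
  "L2_interval l f \<longleftrightarrow>
     f \<in> borel_measurable (lebesgue_on {0..l}) \<and> integrable (lebesgue_on {0..l}) (\<lambda>x. (f x)\<^sup>2)"

definition L2 :: "('v, 'e) metric_graph \<Rightarrow> ('e \<Rightarrow> real \<Rightarrow> real) set" where
  "L2 G = {f. \<forall>e\<in>arcs (underlying G). L2_interval (len G e) (f e)}"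

definition L2_inner ::
    "('v, 'e) metric_graph \<Rightarrow> ('e \<Rightarrow> real \<Rightarrow> real) \<Rightarrow> ('e \<Rightarrow> real \<Rightarrow> real) \<Rightarrow> real" where
  "L2_inner G f g = graph_integral G (\<lambda>e x. f e x * g e x)"

definition L2_norm :: "('v, 'e) metric_graph \<Rightarrow> ('e \<Rightarrow> real \<Rightarrow> real) \<Rightarrow> real" where
  "L2_norm G f = sqrt (L2_inner G f f)"

definition L2_sums ::
    "('v, 'e) metric_graph \<Rightarrow> (nat \<Rightarrow> 'e \<Rightarrow> real \<Rightarrow> real) \<Rightarrow> ('e \<Rightarrow> real \<Rightarrow> real) \<Rightarrow> bool" where
  "L2_sums G F f \<longleftrightarrow> (\<lambda>N. L2_norm G (\<lambda>e x. f e x - (\<Sum>n<N. F n e x))) \<longlonglongrightarrow> 0"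

definition orthonormal_basis :: "('v, 'e) metric_graph \<Rightarrow> (nat \<Rightarrow> 'e \<Rightarrow> real \<Rightarrow> real) \<Rightarrow> bool" where
  "orthonormal_basis G \<phi> \<longleftrightarrow>
     (\<forall>n. \<phi> n \<in> L2 G) \<and>
     (\<forall>m n. L2_inner G (\<phi> m) (\<phi> n) = (if m = n then 1 else 0)) \<and>
     (\<forall>f\<in>L2 G. L2_sums G (\<lambda>n e x. L2_inner G f (\<phi> n) * \<phi> n e x) f)"


section \<open>The Laplacian\<close>

text \<open>
  \<open>H2_interval l f f' f''\<close>: \<open>f\<close> is (the continuously differentiable representative of) an
  element of the Sobolev space \<open>H\<^sup>2(0,l)\<close>, with first derivative \<open>f'\<close>, one-sided at the end
  points, and second weak derivative \<open>f''\<close>. That is, \<open>f'\<close> is absolutely continuous with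
  square-integrable derivative \<open>f''\<close>.
\<close>

definition H2_interval ::
    "real \<Rightarrow> (real \<Rightarrow> real) \<Rightarrow> (real \<Rightarrow> real) \<Rightarrow> (real \<Rightarrow> real) \<Rightarrow> bool" where
  "H2_interval l f f' f'' \<longleftrightarrow>
     (\<forall>x\<in>{0..l}. (f has_real_derivative f' x) (at x within {0..l})) \<and>
     L2_interval l f'' \<and>
     (\<forall>x\<in>{0..l}. f' x = f' 0 + integral\<^sup>L (lebesgue_on {0..x}) f'')"

text \<open>The function \<open>c\<close> collects the common values of \<open>f\<close> at the vertices.\<close>

definition vertex_conditions ::
    "('v, 'e) metric_graph \<Rightarrow> ('e \<Rightarrow> real \<Rightarrow> real) \<Rightarrow> bool" where
  "vertex_conditions G f \<longleftrightarrow>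
     (\<exists>c. (\<forall>e\<in>arcs (underlying G).
             f e 0 = c (tail (underlying G) e) \<and> f e (len G e) = c (head (underlying G) e)) \<and>
          (\<forall>v\<in>dirichlet_verts G. c v = 0))"

text \<open>
  The derivative pointing into the vertex is \<open>f'\<close> at the end \<open>len e\<close> and \<open>-f'\<close> at the end \<open>0\<close>.
  A loop contributes to both sums.
\<close>

definition kirchhoff_condition ::
    "('v, 'e) metric_graph \<Rightarrow> ('e \<Rightarrow> real \<Rightarrow> real) \<Rightarrow> bool" where
  "kirchhoff_condition G f' \<longleftrightarrow>
     (\<forall>v\<in>verts (underlying G) - dirichlet_verts G.
        (\<Sum>e\<in>{e\<in>arcs (underlying G). head (underlying G) e = v}. f' e (len G e)) +
        (\<Sum>e\<in>{e\<in>arcs (underlying G). tail (underlying G) e = v}. - f' e 0) = 0)"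

text \<open>
  \<open>neg_laplacian G f g\<close>: \<open>f\<close> belongs to the domain of the Laplacian \<open>\<Delta>\<close> and \<open>-\<Delta> f = g\<close> a.e.
\<close>

definition neg_laplacian ::
    "('v, 'e) metric_graph \<Rightarrow> ('e \<Rightarrow> real \<Rightarrow> real) \<Rightarrow> ('e \<Rightarrow> real \<Rightarrow> real) \<Rightarrow> bool" where
  "neg_laplacian G f g \<longleftrightarrow>
     (\<exists>f'. (\<forall>e\<in>arcs (underlying G). H2_interval (len G e) (f e) (f' e) (\<lambda>x. - g e x)) \<and>
           vertex_conditions G f \<and> kirchhoff_condition G f')"

text \<open>
  Eigenvalues are listed with multiplicity, indexed from \<open>0\<close>. In the presence of a Dirichlet
  vertex on a connected graph, positivity and divergence of \<open>lam\<close> are consequences.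
\<close>

definition spectral_basis ::
    "('v, 'e) metric_graph \<Rightarrow> (nat \<Rightarrow> real) \<Rightarrow> (nat \<Rightarrow> 'e \<Rightarrow> real \<Rightarrow> real) \<Rightarrow> bool" where
  "spectral_basis G lam \<phi> \<longleftrightarrow>
     incseq lam \<and> orthonormal_basis G \<phi> \<and>
     (\<forall>n. neg_laplacian G (\<phi> n) (\<lambda>e x. lam n * \<phi> n e x))"


section \<open>Fractional torsion\<close>

text \<open>
  In this section \<open>lam\<close>, \<open>\<phi>\<close> are meant to satisfy \<open>spectral_basis G lam \<phi>\<close>.
  \<open>frac_laplacian G lam \<phi> \<alpha> f g\<close>: \<open>f\<close> belongs to the domain of \<open>(-\<Delta>)\<^sup>\<alpha>\<close> and
  \<open>(-\<Delta>)\<^sup>\<alpha> f = g\<close> in \<open>L2 G\<close>.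
\<close>

definition frac_laplacian ::
    "('v, 'e) metric_graph \<Rightarrow> (nat \<Rightarrow> real) \<Rightarrow> (nat \<Rightarrow> 'e \<Rightarrow> real \<Rightarrow> real) \<Rightarrow> real \<Rightarrow>
     ('e \<Rightarrow> real \<Rightarrow> real) \<Rightarrow> ('e \<Rightarrow> real \<Rightarrow> real) \<Rightarrow> bool" where
  "frac_laplacian G lam \<phi> \<alpha> f g \<longleftrightarrow>
     f \<in> L2 G \<and> summable (\<lambda>n. lam n powr (2 * \<alpha>) * (L2_inner G f (\<phi> n))\<^sup>2) \<and>
     g \<in> L2 G \<and> L2_sums G (\<lambda>n e x. lam n powr \<alpha> * L2_inner G f (\<phi> n) * \<phi> n e x) g"

text \<open>The solution is unique only up to a.e.-equality, hence a choice of representative.\<close>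

definition frac_torsion_function ::
    "('v, 'e) metric_graph \<Rightarrow> (nat \<Rightarrow> real) \<Rightarrow> (nat \<Rightarrow> 'e \<Rightarrow> real \<Rightarrow> real) \<Rightarrow> real \<Rightarrow>
     ('e \<Rightarrow> real \<Rightarrow> real)" where
  "frac_torsion_function G lam \<phi> \<alpha> = (SOME u. frac_laplacian G lam \<phi> \<alpha> u (\<lambda>e x. 1))"

definition frac_torsional_rigidity ::
    "('v, 'e) metric_graph \<Rightarrow> (nat \<Rightarrow> real) \<Rightarrow> (nat \<Rightarrow> 'e \<Rightarrow> real \<Rightarrow> real) \<Rightarrow> real \<Rightarrow> real" where
  "frac_torsional_rigidity G lam \<phi> \<alpha> = graph_integral G (frac_torsion_function G lam \<phi> \<alpha>)"

definition zeta_series :: "real \<Rightarrow> real" where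
  "zeta_series s = (\<Sum>n. real (Suc n) powr - s)"

end

theory Submission
  imports Defs
begin

text \<open>
  Since \<open>l powr - \<alpha>\<close> is a positive multiple of the integral of \<open>s powr - \<alpha> / (s + l)\<close> over \<open>s > 0\<close>, it
  suffices to compare, for each \<open>s > 0\<close>, the sums of \<open>\<langle>1, \<phi> n\<rangle>\<^sup>2 / (s + lam n)\<close>. Such a sum is the supremum of
  \<open>2 * \<integral> f - s * \<integral> f\<^sup>2 - \<integral> f'\<^sup>2\<close> over the form domain. Instead of rearranging \<open>f\<close>, this functional is
  bounded by a calibration: Young's inequality with the slope of the solution of \<open>- u'' + s * u = 1\<close>
  on an interval, expressed as a function of the value of \<open>u\<close>, makes the integrand constant up to a
  term controlled by the oscillation of a primitive of that slope between a Dirichlet vertex and a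
  maximum of \<open>f\<close>, which is where connectedness enters. On the interval the resolvent is explicit, and so
  is the spectrum.
\<close>

section \<open>Hilbert space structure of \<open>L2\<close>\<close>

text \<open>The fractional power is nonlocal, whereas the resolvent at a fixed \<open>s\<close> has
  a variational principle whose integrand involves \<open>f\<close> and \<open>f'\<close> alone;
  this is what lets a pointwise inequality do the work. On \<open>G\<close> an upper bound suffices:
  the test functions are partial sums of the eigenfunction expansion, so no resolvent equation is
  solved there and every function involved is C^1 on closed edges. On the interval the explicit
  solution and Parseval give equality. The slope is fitted to the maximum of \<open>f\<close>, not
  to the total length, so the calibrating interval has in general a length \<open>l\<close>
  different from \<open>total_length G\<close>, possibly infinite; the bounds for all
  \<open>l\<close> are compared with the one for \<open>total_length G\<close> through the tangents
  of \<open>tanh\<close>. Since \<open>frac_torsion_function\<close> is a \<open>SOME\<close>,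
  nothing is known about it until a solution has been constructed; this is why completeness of
  \<open>L2\<close> is proved. The spectral basis of the interval is likewise arbitrary, so it has
  to be identified with the sines, up to order and sign, before the zeta value can be read
  off.\<close>

lemma L2_interval_cmult: "L2_interval l f \<Longrightarrow> L2_interval l (\<lambda>x. c * f x)"
  by (auto simp: L2_interval_def power_mult_distrib)

lemma L2_interval_mult:
  assumes "L2_interval l f" "L2_interval l g"
  shows "integrable (lebesgue_on {0..l}) (\<lambda>x. f x * g x)"
proof -
  have [measurable]: "f \<in> borel_measurable (lebesgue_on {0..l})" "g \<in> borel_measurable (lebesgue_on {0..l})"
    using assms by (auto simp: L2_interval_def)
  have "integrable (lebesgue_on {0..l}) (\<lambda>x. (f x)\<^sup>2 + (g x)\<^sup>2)"
    using assms by (auto simp: L2_interval_def)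
  then show ?thesis
  proof (rule Bochner_Integration.integrable_bound)
    show "(\<lambda>x. f x * g x) \<in> borel_measurable (lebesgue_on {0..l})"
      by measurable
    show "AE x in lebesgue_on {0..l}. norm (f x * g x) \<le> norm ((f x)\<^sup>2 + (g x)\<^sup>2)"
    proof (rule AE_I2)
      fix x
      have "2 * \<bar>f x\<bar> * \<bar>g x\<bar> \<le> \<bar>f x\<bar>\<^sup>2 + \<bar>g x\<bar>\<^sup>2"
        by (rule sum_squares_bound)
      moreover have "0 \<le> \<bar>f x\<bar> * \<bar>g x\<bar>" by simp
      ultimately have "\<bar>f x\<bar> * \<bar>g x\<bar> \<le> (f x)\<^sup>2 + (g x)\<^sup>2"
        unfolding power2_abs by linarith
      then show "norm (f x * g x) \<le> norm ((f x)\<^sup>2 + (g x)\<^sup>2)"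
        by (simp add: abs_mult)
    qed
  qed
qed

lemma L2_interval_add:
  assumes "L2_interval l f" "L2_interval l g"
  shows "L2_interval l (\<lambda>x. f x + g x)"
proof -
  have "integrable (lebesgue_on {0..l}) (\<lambda>x. (f x)\<^sup>2 + (g x)\<^sup>2 + 2 * (f x * g x))"
    using assms L2_interval_mult[OF assms] by (auto simp: L2_interval_def)
  then show ?thesis
    using assms by (auto simp: L2_interval_def power2_sum algebra_simps)
qed

lemma L2_interval_diff:
  assumes "L2_interval l f" "L2_interval l g"
  shows "L2_interval l (\<lambda>x. f x - g x)"
  using L2_interval_add[OF assms(1) L2_interval_cmult[OF assms(2), of "-1"]] by simp

lemma L2_interval_continuous: "continuous_on {0..l} f \<Longrightarrow> L2_interval l f"
  unfolding L2_interval_def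
  by (intro conjI continuous_imp_integrable_real continuous_intros continuous_imp_measurable_on_sets_lebesgue) auto

lemma L2_cmult: "f \<in> L2 G \<Longrightarrow> (\<lambda>e x. c * f e x) \<in> L2 G"
  by (auto simp: L2_def L2_interval_cmult)

lemma L2_add: "f \<in> L2 G \<Longrightarrow> g \<in> L2 G \<Longrightarrow> (\<lambda>e x. f e x + g e x) \<in> L2 G"
  by (auto simp: L2_def L2_interval_add)

lemma L2_diff: "f \<in> L2 G \<Longrightarrow> g \<in> L2 G \<Longrightarrow> (\<lambda>e x. f e x - g e x) \<in> L2 G"
  by (auto simp: L2_def L2_interval_diff)

lemma L2_const: "(\<lambda>e x. c) \<in> L2 G"
  by (auto simp: L2_def intro!: L2_interval_continuous)

lemma L2_sum:
  assumes "finite A" "\<And>i. i \<in> A \<Longrightarrow> F i \<in> L2 G"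
  shows "(\<lambda>e x. \<Sum>i\<in>A. F i e x) \<in> L2 G"
  using assms by (induction A) (auto intro: L2_add L2_const)

lemma L2_inner_commute: "L2_inner G f g = L2_inner G g f"
  by (simp add: L2_inner_def mult.commute)

text \<open>No integrability is asked for: on an edge where the product is not integrable, the
  Bochner integral takes its default value 0 on both sides.\<close>

lemma L2_inner_cmult_left: "L2_inner G (\<lambda>e x. c * f e x) g = c * L2_inner G f g"
  by (simp add: L2_inner_def graph_integral_def sum_distrib_left mult.assoc)

lemma L2_inner_add_left:
  assumes "f \<in> L2 G" "g \<in> L2 G" "h \<in> L2 G"
  shows "L2_inner G (\<lambda>e x. f e x + g e x) h = L2_inner G f h + L2_inner G g h"
  using assms
  by (auto simp: L2_inner_def graph_integral_def sum.distrib[symmetric] L2_def distrib_right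
      intro!: sum.cong Bochner_Integration.integral_add L2_interval_mult)

lemma L2_inner_diff_left:
  assumes "f \<in> L2 G" "g \<in> L2 G" "h \<in> L2 G"
  shows "L2_inner G (\<lambda>e x. f e x - g e x) h = L2_inner G f h - L2_inner G g h"
  using assms
  by (auto simp: L2_inner_def graph_integral_def sum_subtractf[symmetric] L2_def left_diff_distrib
      intro!: sum.cong Bochner_Integration.integral_diff L2_interval_mult)

lemma L2_inner_sum_left:
  assumes "finite A" "\<And>i. i \<in> A \<Longrightarrow> F i \<in> L2 G" "h \<in> L2 G"
  shows "L2_inner G (\<lambda>e x. \<Sum>i\<in>A. F i e x) h = (\<Sum>i\<in>A. L2_inner G (F i) h)"
  using assms
proof (induction A)
  case empty
  then show ?case by (simp add: L2_inner_def graph_integral_def)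
next
  case (insert i A)
  then show ?case by (simp add: L2_inner_add_left L2_sum)
qed

lemma L2_inner_self_nonneg: "0 \<le> L2_inner G f f"
  by (auto simp: L2_inner_def graph_integral_def intro!: sum_nonneg)

lemma L2_inner_expand:
  assumes "f \<in> L2 G" "g \<in> L2 G"
  shows "L2_inner G (\<lambda>e x. f e x - t * g e x) (\<lambda>e x. f e x - t * g e x)
         = L2_inner G f f - 2 * t * L2_inner G f g + t\<^sup>2 * L2_inner G g g"
proof -
  let ?d = "\<lambda>e x. f e x - t * g e x"
  have d: "?d \<in> L2 G" "(\<lambda>e x. t * g e x) \<in> L2 G"
    using L2_diff[OF assms(1) L2_cmult[OF assms(2)]] L2_cmult[OF assms(2)] by auto
  have "L2_inner G ?d ?d = L2_inner G f ?d - t * L2_inner G g ?d"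
    using L2_inner_diff_left[OF assms(1) d(2) d(1)] by (simp add: L2_inner_cmult_left)
  also have "L2_inner G f ?d = L2_inner G f f - t * L2_inner G g f"
    using L2_inner_diff_left[OF assms(1) d(2) assms(1)]
    by (simp add: L2_inner_cmult_left L2_inner_commute[of G f ?d])
  also have "L2_inner G g ?d = L2_inner G f g - t * L2_inner G g g"
    using L2_inner_diff_left[OF assms(1) d(2) assms(2)]
    by (simp add: L2_inner_cmult_left L2_inner_commute[of G g ?d])
  finally show ?thesis
    by (simp add: L2_inner_commute[of G g f] algebra_simps power2_eq_square)
qed

lemma L2_Cauchy_Schwarz:
  assumes "f \<in> L2 G" "g \<in> L2 G"
  shows "\<bar>L2_inner G f g\<bar> \<le> L2_norm G f * L2_norm G g"
proof -
  have q: "0 \<le> L2_inner G f f - 2 * t * L2_inner G f g + t\<^sup>2 * L2_inner G g g" for t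
    using L2_inner_self_nonneg[of G "\<lambda>e x. f e x - t * g e x"]
    by (simp only: L2_inner_expand[OF assms])
  have "(L2_inner G f g)\<^sup>2 \<le> L2_inner G f f * L2_inner G g g"
  proof (cases "L2_inner G g g = 0")
    case True
    have "L2_inner G f g = 0"
    proof (rule ccontr)
      assume "L2_inner G f g \<noteq> 0"
      \<comment> \<open>The quadratic has degenerated to an affine function of \<open>t\<close>; at
        this \<open>t\<close> its value is -1.\<close>
      then show False
        using q[of "(L2_inner G f f + 1) / (2 * L2_inner G f g)"] True by (simp add: field_simps)
    qed
    then show ?thesis using True by simp
  next
    case False
    then have "0 < L2_inner G g g" using L2_inner_self_nonneg[of G g] by linarith
    then show ?thesis
      using q[of "L2_inner G f g / L2_inner G g g"]
      by (simp add: field_simps power2_eq_square)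
  qed
  then have "sqrt ((L2_inner G f g)\<^sup>2) \<le> sqrt (L2_inner G f f * L2_inner G g g)"
    by (rule real_sqrt_le_mono)
  then show ?thesis by (simp add: L2_norm_def real_sqrt_mult)
qed

text \<open>Pairing with a fixed \<open>g\<close> is norm-continuous by Cauchy-Schwarz, so it passes
  through the \<open>L2\<close> limit of the partial sums.\<close>

lemma L2_sums_inner:
  assumes F: "\<And>n. F n \<in> L2 G" and f: "f \<in> L2 G" and g: "g \<in> L2 G" and sums: "L2_sums G F f"
  shows "(\<lambda>n. L2_inner G (F n) g) sums L2_inner G f g"
proof -
  let ?S = "\<lambda>N e x. \<Sum>n<N. F n e x"
  have S: "?S N \<in> L2 G" for N by (intro L2_sum F) auto
  have "(\<lambda>N. L2_inner G f g - (\<Sum>n<N. L2_inner G (F n) g)) \<longlonglongrightarrow> 0"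
  proof (rule Lim_null_comparison)
    have "L2_inner G f g - (\<Sum>n<N. L2_inner G (F n) g) = L2_inner G (\<lambda>e x. f e x - ?S N e x) g" for N
      by (subst L2_inner_diff_left[OF f S g], subst L2_inner_sum_left) (auto intro: F g)
    then show "\<forall>\<^sub>F N in sequentially. norm (L2_inner G f g - (\<Sum>n<N. L2_inner G (F n) g))
                 \<le> L2_norm G (\<lambda>e x. f e x - ?S N e x) * L2_norm G g"
      using L2_Cauchy_Schwarz[OF L2_diff[OF f S] g] by auto
    show "(\<lambda>N. L2_norm G (\<lambda>e x. f e x - ?S N e x) * L2_norm G g) \<longlonglongrightarrow> 0"
      using sums unfolding L2_sums_def by (rule tendsto_mult_left_zero)
  qed
  then show ?thesis
    unfolding sums_def using LIM_zero_cancel[of "\<lambda>N. - (\<Sum>n<N. L2_inner G (F n) g)" "- L2_inner G f g"]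
    by (simp add: tendsto_minus_cancel_left)
qed

lemma Parseval:
  assumes "orthonormal_basis G \<phi>" "f \<in> L2 G" "g \<in> L2 G"
  shows "(\<lambda>n. L2_inner G f (\<phi> n) * L2_inner G g (\<phi> n)) sums L2_inner G f g"
proof -
  have "(\<lambda>n. L2_inner G (\<lambda>e x. L2_inner G f (\<phi> n) * \<phi> n e x) g) sums L2_inner G f g"
    using assms by (intro L2_sums_inner L2_cmult) (auto simp: orthonormal_basis_def)
  then show ?thesis
    by (simp add: L2_inner_cmult_left L2_inner_commute[of G g])
qed

text \<open>On a bounded interval an L^2-Cauchy sequence is L^1-Cauchy, so a subsequence converges
  almost everywhere. Fatou's lemma along that subsequence then controls the distance from the limit
  to every late \<open>S n\<close>.\<close>

lemma L2_interval_complete: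
  assumes S: "\<And>n. L2_interval l (S n)"
    and Cauchy: "\<And>\<epsilon>. 0 < \<epsilon> \<Longrightarrow>
      \<exists>N. \<forall>m\<ge>N. \<forall>n\<ge>N. (LINT x|lebesgue_on {0..l}. (S m x - S n x)\<^sup>2) < \<epsilon>"
  obtains u where "L2_interval l u"
    "(\<lambda>n. LINT x|lebesgue_on {0..l}. (u x - S n x)\<^sup>2) \<longlonglongrightarrow> 0"
proof -
  let ?M = "lebesgue_on {0..l}"
  have fin: "finite_measure ?M"
    by (intro finite_measureI) (auto simp: emeasure_restrict_space emeasure_lborel_Icc_eq split: if_splits)
  have one: "L2_interval l (\<lambda>x. 1)" by (rule L2_interval_continuous) simp
  have meas [measurable]: "S n \<in> borel_measurable ?M" for n
    using S by (auto simp: L2_interval_def)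
  have int: "integrable ?M (S n)" for n
    using L2_interval_mult[OF S one] by simp
  have sq: "integrable ?M (\<lambda>x. (S m x - S n x)\<^sup>2)" for m n
    using L2_interval_diff[OF S S] by (auto simp: L2_interval_def)
  \<comment> \<open>Young's inequality with a free weight \<open>\<delta>\<close>;
    \<open>\<bar>l\<bar> + 1\<close> bounds the measure of the interval for every sign of
    \<open>l\<close> and can be divided by.\<close>
  have L1: "(LINT x|?M. norm (S m x - S n x)) \<le> \<delta> * (\<bar>l\<bar> + 1) / 2 + (LINT x|?M. (S m x - S n x)\<^sup>2) / (2 * \<delta>)"
    if "0 < \<delta>" for m n and \<delta> :: real
  proof -
    have "(LINT x|?M. norm (S m x - S n x)) \<le> (LINT x|?M. \<delta> / 2 + (S m x - S n x)\<^sup>2 / (2 * \<delta>))"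
    proof (rule integral_mono)
      show "integrable ?M (\<lambda>x. norm (S m x - S n x))" using int by auto
      show "integrable ?M (\<lambda>x. \<delta> / 2 + (S m x - S n x)\<^sup>2 / (2 * \<delta>))"
        using sq fin by (auto intro!: Bochner_Integration.integrable_add finite_measure.integrable_const)
      fix x
      have "0 \<le> (\<delta> - \<bar>S m x - S n x\<bar>)\<^sup>2" by simp
      also have "\<dots> = \<delta>\<^sup>2 - 2 * \<delta> * \<bar>S m x - S n x\<bar> + (S m x - S n x)\<^sup>2"
        by (simp add: power2_diff)
      finally show "norm (S m x - S n x) \<le> \<delta> / 2 + (S m x - S n x)\<^sup>2 / (2 * \<delta>)"
        using that by (simp add: field_simps power2_eq_square)
    qed
    also have "\<dots> = \<delta> / 2 * measure ?M (space ?M) + (LINT x|?M. (S m x - S n x)\<^sup>2) / (2 * \<delta>)"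
      using sq fin by (simp add: finite_measure.integrable_const)
    also have "measure ?M (space ?M) \<le> \<bar>l\<bar> + 1"
      by (simp add: measure_restrict_space)
    finally show ?thesis using that by (simp add: mult_left_mono)
  qed
  have "\<exists>N. \<forall>i\<ge>N. \<forall>j\<ge>N. (LINT x|?M. norm (S i x - S j x)) < \<epsilon>" if "0 < \<epsilon>" for \<epsilon>
  proof -
    \<comment> \<open>With this weight the constant term of \<open>L1\<close> is half of
      \<open>\<epsilon>\<close>, and an integral of squares below
      \<open>\<delta> * \<epsilon>\<close> contributes less than the other half.\<close>
    define \<delta> where "\<delta> = \<epsilon> / (\<bar>l\<bar> + 1)"
    have \<delta>: "0 < \<delta>" "\<delta> * (\<bar>l\<bar> + 1) = \<epsilon>" using that by (auto simp: \<delta>_def)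
    obtain N where N: "\<forall>m\<ge>N. \<forall>n\<ge>N. (LINT x|?M. (S m x - S n x)\<^sup>2) < \<delta> * \<epsilon>"
      using Cauchy[of "\<delta> * \<epsilon>"] \<delta> that by auto
    have "(LINT x|?M. norm (S i x - S j x)) < \<epsilon>" if "i \<ge> N" "j \<ge> N" for i j
    proof -
      have "(LINT x|?M. (S i x - S j x)\<^sup>2) / (2 * \<delta>) < \<delta> * \<epsilon> / (2 * \<delta>)"
        using N that \<delta> by (intro divide_strict_right_mono) auto
      then show ?thesis using L1[OF \<delta>(1), of i j] \<delta> by simp
    qed
    then show ?thesis by auto
  qed
  then obtain r where r: "strict_mono r" "AE x in ?M. Cauchy (\<lambda>i. S (r i) x)"
    using cauchy_L1_AE_cauchy_subseq[of ?M S] int by blast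
  define u where "u x = lim (\<lambda>i. S (r i) x)" for x
  have [measurable]: "u \<in> borel_measurable ?M"
    unfolding u_def by (rule borel_measurable_lim_metric) simp
  have conv: "AE x in ?M. (\<lambda>i. S (r i) x) \<longlonglongrightarrow> u x"
    using r(2) by eventually_elim (auto simp: u_def Cauchy_convergent_iff convergent_LIMSEQ_iff)
  \<comment> \<open>Fatou yields integrability of the square and the bound on its integral at
    once.\<close>
  have key: "integrable ?M (\<lambda>x. (u x - S n x)\<^sup>2) \<and> (LINT x|?M. (u x - S n x)\<^sup>2) \<le> \<epsilon>"
    if n: "\<And>m. m \<ge> N \<Longrightarrow> (LINT x|?M. (S m x - S n x)\<^sup>2) < \<epsilon>" and "0 < \<epsilon>" for n N \<epsilon>
  proof -
    have "(\<integral>\<^sup>+x. ennreal ((u x - S n x)\<^sup>2) \<partial>?M)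
        = (\<integral>\<^sup>+x. liminf (\<lambda>i. ennreal ((S (r i) x - S n x)\<^sup>2)) \<partial>?M)"
    proof (rule nn_integral_cong_AE)
      show "AE x in ?M. ennreal ((u x - S n x)\<^sup>2) = liminf (\<lambda>i. ennreal ((S (r i) x - S n x)\<^sup>2))"
        using conv
      proof eventually_elim
        case (elim x)
        then have "(\<lambda>i. ennreal ((S (r i) x - S n x)\<^sup>2)) \<longlonglongrightarrow> ennreal ((u x - S n x)\<^sup>2)"
          by (intro tendsto_ennrealI tendsto_intros)
        from lim_imp_Liminf[OF _ this] show ?case by simp
      qed
    qed
    also have "\<dots> \<le> liminf (\<lambda>i. \<integral>\<^sup>+x. ennreal ((S (r i) x - S n x)\<^sup>2) \<partial>?M)"
      by (rule nn_integral_liminf) simp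
    also have "\<dots> \<le> ennreal \<epsilon>"
    proof (rule Liminf_le)
      show "\<forall>\<^sub>F i in sequentially. (\<integral>\<^sup>+x. ennreal ((S (r i) x - S n x)\<^sup>2) \<partial>?M) \<le> ennreal \<epsilon>"
        using eventually_ge_at_top[of N]
      proof eventually_elim
        case (elim i)
        then have "N \<le> r i" using seq_suble[OF r(1), of i] by linarith
        then show ?case
          using n[of "r i"] by (subst nn_integral_eq_integral[OF sq]) (auto simp: less_imp_le ennreal_leI)
      qed
    qed simp
    finally have le: "(\<integral>\<^sup>+x. ennreal ((u x - S n x)\<^sup>2) \<partial>?M) \<le> ennreal \<epsilon>" .
    have "(\<integral>\<^sup>+x. ennreal ((u x - S n x)\<^sup>2) \<partial>?M) < \<infinity>"
      using le_less_trans[OF le ennreal_less_top] by simp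
    then have i: "integrable ?M (\<lambda>x. (u x - S n x)\<^sup>2)"
      by (intro integrableI_bounded) auto
    then show ?thesis
      using le that(2) by (simp add: nn_integral_eq_integral)
  qed
  have ev: "\<exists>N. \<forall>n\<ge>N. integrable ?M (\<lambda>x. (u x - S n x)\<^sup>2) \<and> (LINT x|?M. (u x - S n x)\<^sup>2) \<le> \<epsilon>"
    if "0 < \<epsilon>" for \<epsilon>
    using Cauchy[OF that] key that by meson
  obtain n where "integrable ?M (\<lambda>x. (u x - S n x)\<^sup>2)" using ev[of 1] by auto
  then have "L2_interval l (\<lambda>x. u x - S n x)" by (auto simp: L2_interval_def)
  from L2_interval_add[OF this S[of n]] have "L2_interval l u" by simp
  moreover have "(\<lambda>n. LINT x|?M. (u x - S n x)\<^sup>2) \<longlonglongrightarrow> 0"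
  proof (rule LIMSEQ_I)
    fix \<epsilon> :: real assume "0 < \<epsilon>"
    then obtain N where "\<forall>n\<ge>N. (LINT x|?M. (u x - S n x)\<^sup>2) \<le> \<epsilon> / 2" using ev[of "\<epsilon> / 2"] by auto
    then show "\<exists>N. \<forall>n\<ge>N. norm ((LINT x|?M. (u x - S n x)\<^sup>2) - 0) < \<epsilon>"
      using \<open>0 < \<epsilon>\<close> by (intro exI[of _ N]) force
  qed
  ultimately show thesis by (rule that)
qed

text \<open>\<open>orthonormal_basis\<close> expands given elements of \<open>L2\<close>; here an
  element is produced from given coefficients. By Pythagoras the partial sums are Cauchy, each edge
  term is dominated by the whole, and finitely many edgewise limits are glued together.\<close>

lemma Riesz_Fischer:
  assumes "finite (arcs (underlying G))" "orthonormal_basis G \<phi>" "summable (\<lambda>n. (c n)\<^sup>2)"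
  obtains u where "u \<in> L2 G" "L2_sums G (\<lambda>n e x. c n * \<phi> n e x) u" "\<And>n. L2_inner G u (\<phi> n) = c n"
proof -
  let ?E = "arcs (underlying G)"
  define S where "S N e x = (\<Sum>n<N. c n * \<phi> n e x)" for N e x
  have \<phi>: "\<phi> n \<in> L2 G" and on: "L2_inner G (\<phi> m) (\<phi> n) = (if m = n then 1 else 0)" for m n
    using assms(2) by (auto simp: orthonormal_basis_def)
  have S: "S N \<in> L2 G" for N
    unfolding S_def[abs_def] by (intro L2_sum L2_cmult \<phi>) auto
  have inner: "L2_inner G (\<lambda>e x. \<Sum>i\<in>A. c i * \<phi> i e x) (\<phi> n) = (if n \<in> A then c n else 0)"
    if "finite A" for A n
    using that by (subst L2_inner_sum_left) (auto intro: L2_cmult \<phi> simp: L2_inner_cmult_left on if_distrib cong: if_cong)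
  have inner2: "L2_inner G (\<lambda>e x. \<Sum>i\<in>A. c i * \<phi> i e x) (\<lambda>e x. \<Sum>i\<in>A. c i * \<phi> i e x) = (\<Sum>i\<in>A. (c i)\<^sup>2)"
    if "finite A" for A
  proof -
    have "L2_inner G (\<lambda>e x. \<Sum>i\<in>A. c i * \<phi> i e x) (\<lambda>e x. \<Sum>i\<in>A. c i * \<phi> i e x)
        = (\<Sum>i\<in>A. c i * L2_inner G (\<phi> i) (\<lambda>e x. \<Sum>i\<in>A. c i * \<phi> i e x))"
      using that by (subst L2_inner_sum_left) (auto intro!: L2_sum L2_cmult \<phi> simp: L2_inner_cmult_left)
    also have "\<dots> = (\<Sum>i\<in>A. (c i)\<^sup>2)"
      using inner[OF that] by (auto intro!: sum.cong simp: L2_inner_commute[of G "\<phi> _"] power2_eq_square)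
    finally show ?thesis .
  qed
  have diff: "L2_inner G (\<lambda>e x. S m e x - S n e x) (\<lambda>e x. S m e x - S n e x) = (\<Sum>i=n..<m. (c i)\<^sup>2)"
    if "n \<le> m" for m n
  proof -
    have "(\<lambda>e x. S m e x - S n e x) = (\<lambda>e x. \<Sum>i=n..<m. c i * \<phi> i e x)"
      using that unfolding S_def lessThan_atLeast0 by (auto simp: fun_eq_iff sum_diff_nat_ivl)
    then show ?thesis using inner2 by simp
  qed
  have Cauchy: "\<exists>N. \<forall>m\<ge>N. \<forall>n\<ge>N. L2_inner G (\<lambda>e x. S m e x - S n e x) (\<lambda>e x. S m e x - S n e x) < \<epsilon>"
    if \<epsilon>: "0 < \<epsilon>" for \<epsilon>
  proof -
    obtain N where N: "\<And>m n. m \<ge> N \<Longrightarrow> norm (\<Sum>i=m..<n. (c i)\<^sup>2) < \<epsilon>"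
      using assms(3) \<epsilon> unfolding summable_Cauchy by blast
    have "L2_inner G (\<lambda>e x. S m e x - S n e x) (\<lambda>e x. S m e x - S n e x) < \<epsilon>" if "m \<ge> N" "n \<ge> N" for m n
    proof (cases "n \<le> m")
      case True
      then show ?thesis using diff[OF True] N[of n m] that by auto
    next
      case False
      have "L2_inner G (\<lambda>e x. S m e x - S n e x) (\<lambda>e x. S m e x - S n e x)
          = L2_inner G (\<lambda>e x. S n e x - S m e x) (\<lambda>e x. S n e x - S m e x)"
        by (simp add: L2_inner_def graph_integral_def algebra_simps)
      then show ?thesis using diff[of m n] False N[of m n] that by auto
    qed
    then show ?thesis by auto
  qed
  have edge: "\<exists>v. L2_interval (len G e) v \<and>
      (\<lambda>n. LINT x|lebesgue_on {0..len G e}. (v x - S n e x)\<^sup>2) \<longlonglongrightarrow> 0" if e: "e \<in> ?E" for e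
  proof (rule L2_interval_complete[of "len G e" "\<lambda>n. S n e"])
    show "L2_interval (len G e) (S n e)" for n using S e by (auto simp: L2_def)
    fix \<epsilon> :: real assume "0 < \<epsilon>"
    from Cauchy[OF this] obtain N where
      N: "\<And>m n. m \<ge> N \<Longrightarrow> n \<ge> N \<Longrightarrow> L2_inner G (\<lambda>e x. S m e x - S n e x) (\<lambda>e x. S m e x - S n e x) < \<epsilon>" by auto
    have "(LINT x|lebesgue_on {0..len G e}. (S m e x - S n e x)\<^sup>2)
        \<le> L2_inner G (\<lambda>e x. S m e x - S n e x) (\<lambda>e x. S m e x - S n e x)" for m n
      unfolding L2_inner_def graph_integral_def power2_eq_square
      by (rule member_le_sum[OF e _ assms(1)]) auto
    then show "\<exists>N. \<forall>m\<ge>N. \<forall>n\<ge>N. (LINT x|lebesgue_on {0..len G e}. (S m e x - S n e x)\<^sup>2) < \<epsilon>"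
      using N by (meson le_less_trans)
  qed auto
  define u where "u e = (SOME v. L2_interval (len G e) v \<and>
      (\<lambda>n. LINT x|lebesgue_on {0..len G e}. (v x - S n e x)\<^sup>2) \<longlonglongrightarrow> 0)" for e
  have u: "L2_interval (len G e) (u e)"
      "(\<lambda>n. LINT x|lebesgue_on {0..len G e}. (u e x - S n e x)\<^sup>2) \<longlonglongrightarrow> 0" if "e \<in> ?E" for e
    using someI_ex[OF edge[OF that]] by (simp_all add: u_def)
  have uL2: "u \<in> L2 G" using u by (auto simp: L2_def)
  have "(\<lambda>n. \<Sum>e\<in>?E. LINT x|lebesgue_on {0..len G e}. (u e x - S n e x)\<^sup>2) \<longlonglongrightarrow> 0"
    using u(2) by (rule tendsto_null_sum)
  then have "(\<lambda>n. sqrt (\<Sum>e\<in>?E. LINT x|lebesgue_on {0..len G e}. (u e x - S n e x)\<^sup>2)) \<longlonglongrightarrow> sqrt 0"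
    by (rule tendsto_real_sqrt)
  then have sums: "L2_sums G (\<lambda>n e x. c n * \<phi> n e x) u"
    by (simp add: L2_sums_def L2_norm_def L2_inner_def graph_integral_def S_def power2_eq_square)
  have "L2_inner G u (\<phi> n) = c n" for n
  proof -
    have "(\<lambda>m. L2_inner G (\<lambda>e x. c m * \<phi> m e x) (\<phi> n)) sums L2_inner G u (\<phi> n)"
      by (intro L2_sums_inner L2_cmult \<phi> uL2 sums)
    then have "(\<lambda>m. if m = n then c n else 0) sums L2_inner G u (\<phi> n)"
      by (simp add: L2_inner_cmult_left on if_distrib cong: if_cong)
    moreover have "(\<lambda>m. if m = n then c n else 0) sums c n" by (rule sums_single)
    ultimately show ?thesis using sums_unique2 by blast
  qed
  then show thesis using that uL2 sums by blast
qed

section \<open>Oscillation on connected graphs and Green's formula\<close>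

text \<open>Induction along a walk in the symmetrised graph. Such a walk may run through an edge
  against its orientation, hence the equivalence in the closedness hypothesis.\<close>

lemma connected_closed_verts:
  fixes G :: "('v, 'e) metric_graph"
  assumes "compact_metric_graph G" "connected_metric_graph G"
    and r: "r \<in> verts (underlying G)" "r \<in> A"
    and closed: "\<And>e. e \<in> arcs (underlying G) \<Longrightarrow>
      tail (underlying G) e \<in> A \<longleftrightarrow> head (underlying G) e \<in> A"
  shows "verts (underlying G) \<subseteq> A"
proof
  fix v assume v: "v \<in> verts (underlying G)"
  have "r \<rightarrow>\<^sup>*\<^bsub>with_proj (mk_symmetric (underlying G))\<^esub> v"
    using assms(2) r(1) v
    by (auto simp: connected_metric_graph_def Digraph_Component.connected_def strongly_connected_def mk_symmetric_def)
  then have "(r, v) \<in> rtrancl_on (verts (underlying G)) (parcs (mk_symmetric (underlying G)))"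
    by (auto simp: reachable_def mk_symmetric_def)
  then show "v \<in> A"
  proof (induction rule: rtrancl_on_induct)
    case base
    then show ?case using r by simp
  next
    case (step y z)
    then show ?case using closed by (auto simp: mk_symmetric_def)
  qed
qed

text \<open>
  A set of vertices on which the bound by the inner edges holds can be enlarged by the far end of
  any edge leaving it, so a maximal one is closed.
\<close>

lemma oscillation_component:
  fixes g :: "'v \<Rightarrow> real" and W :: "'e \<Rightarrow> real"
  assumes "finite V" "finite E" "r \<in> V"
    and ends: "\<And>e. e \<in> E \<Longrightarrow> s e \<in> V \<and> t e \<in> V"
    and W: "\<And>e. e \<in> E \<Longrightarrow> \<bar>g (s e) - g (t e)\<bar> \<le> W e"
  obtains A where "r \<in> A" "\<And>e. e \<in> E \<Longrightarrow> s e \<in> A \<longleftrightarrow> t e \<in> A"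
    "\<And>v. v \<in> A \<Longrightarrow> g v - g r \<le> (\<Sum>e\<in>E. W e)"
proof -
  define I where "I A = {e\<in>E. s e \<in> A \<and> t e \<in> A}" for A
  define \<A> where "\<A> = {A. A \<subseteq> V \<and> r \<in> A \<and> (\<forall>v\<in>A. g v - g r \<le> (\<Sum>e\<in>I A. W e))}"
  have W0: "0 \<le> W e" if "e \<in> E" for e
    using W[OF that] by linarith
  have "finite \<A>"
    by (rule finite_subset[of _ "Pow V"]) (auto simp: \<A>_def assms)
  moreover have "{r} \<in> \<A>"
    using assms W0 by (auto simp: \<A>_def I_def intro!: sum_nonneg)
  ultimately obtain A where A: "A \<in> \<A>" and max: "\<And>B. B \<in> \<A> \<Longrightarrow> A \<subseteq> B \<Longrightarrow> A = B"
    using finite_has_maximal[of \<A>] by (metis empty_iff)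
  have step: False if e: "e \<in> E" and u: "u \<in> A" and w: "w \<in> V" "w \<notin> A"
    and uw: "s e = u \<and> t e = w \<or> s e = w \<and> t e = u" for e u w
  proof -
    have fin: "finite (I (insert w A))" using assms by (auto simp: I_def)
    \<comment> \<open>Since \<open>w\<close> lies outside \<open>A\<close>, the edge
      \<open>e\<close> is not an inner edge of \<open>A\<close> and its weight is still unspent.
      This is how every edge comes to be counted only once.\<close>
    have sub: "insert e (I A) \<subseteq> I (insert w A)" "e \<notin> I A" "finite (I A)"
      using e u w uw assms by (auto simp: I_def)
    have le: "W e + sum W (I A) \<le> sum W (I (insert w A))"
      using sum_mono2[OF fin sub(1), of W] sub W0 by (auto simp: I_def)
    have "\<bar>g w - g u\<bar> \<le> W e"
      using W[OF e] uw by auto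
    moreover have "g u - g r \<le> sum W (I A)" using A u by (auto simp: \<A>_def)
    ultimately have "g w - g r \<le> sum W (I (insert w A))"
      using le by linarith
    moreover have "g v - g r \<le> sum W (I (insert w A))" if "v \<in> A" for v
    proof -
      have "g v - g r \<le> sum W (I A)" using A that by (auto simp: \<A>_def)
      then show ?thesis using le W0[OF e] by linarith
    qed
    ultimately have "insert w A \<in> \<A>"
      using A w by (auto simp: \<A>_def)
    then show False using max[of "insert w A"] w by blast
  qed
  show thesis
  proof (rule that[of A])
    show "r \<in> A" using A by (auto simp: \<A>_def)
    show "s e \<in> A \<longleftrightarrow> t e \<in> A" if "e \<in> E" for e
      using step[OF that, of "s e" "t e"] step[OF that, of "t e" "s e"] ends[OF that] by auto
    fix v assume "v \<in> A"
    then have "g v - g r \<le> sum W (I A)" using A by (auto simp: \<A>_def)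
    also have "\<dots> \<le> sum W E"
      using assms W0 by (intro sum_mono2) (auto simp: I_def)
    finally show "g v - g r \<le> (\<Sum>e\<in>E. W e)" .
  qed
qed

text \<open>The point \<open>x0\<close> may be interior to \<open>e0\<close>, and the weight of
  \<open>e0\<close> pays for the way from an end of \<open>e0\<close> to \<open>x0\<close>. The way
  from \<open>r\<close> to that end must therefore avoid \<open>e0\<close>: the vertex bound is
  taken on the graph without \<open>e0\<close>.\<close>

lemma graph_oscillation_le:
  fixes G :: "('v, 'e) metric_graph" and c :: "'v \<Rightarrow> real"
  assumes G: "compact_metric_graph G" "connected_metric_graph G"
    and r: "r \<in> verts (underlying G)"
    and c: "\<And>e. e \<in> arcs (underlying G) \<Longrightarrow>
      h e 0 = c (tail (underlying G) e) \<and> h e (len G e) = c (head (underlying G) e)"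
    and W: "\<And>e x y. e \<in> arcs (underlying G) \<Longrightarrow> x \<in> {0..len G e} \<Longrightarrow> y \<in> {0..len G e} \<Longrightarrow>
      \<bar>h e x - h e y\<bar> \<le> W e"
    and e0: "e0 \<in> arcs (underlying G)" "x0 \<in> {0..len G e0}"
  shows "h e0 x0 - c r \<le> (\<Sum>e\<in>arcs (underlying G). W e)"
proof -
  let ?E = "arcs (underlying G)" and ?s = "tail (underlying G)" and ?t = "head (underlying G)"
  interpret fin_digraph "underlying G" using G by (simp add: compact_metric_graph_def)
  have l: "0 < len G e" if "e \<in> ?E" for e
    using G that by (auto simp: compact_metric_graph_def)
  have Wc: "\<bar>c (?s e) - c (?t e)\<bar> \<le> W e" if "e \<in> ?E" for e
    using W[OF that, of 0 "len G e"] c[OF that] l[OF that] by auto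
  obtain A where A: "r \<in> A" "\<And>e. e \<in> ?E - {e0} \<Longrightarrow> ?s e \<in> A \<longleftrightarrow> ?t e \<in> A"
      "\<And>v. v \<in> A \<Longrightarrow> c v - c r \<le> (\<Sum>e\<in>?E - {e0}. W e)"
  proof (rule oscillation_component[of "verts (underlying G)" "?E - {e0}" r ?s ?t c W])
    show "\<bar>c (?s e) - c (?t e)\<bar> \<le> W e" if "e \<in> ?E - {e0}" for e using Wc that by auto
  qed (use r in auto)
  \<comment> \<open>If both ends were outside, \<open>A\<close> would be closed under
    \<open>e0\<close> as well, and connectedness would put every vertex into
    \<open>A\<close>.\<close>
  have "?s e0 \<in> A \<or> ?t e0 \<in> A"
  proof (rule ccontr)
    assume n: "\<not> (?s e0 \<in> A \<or> ?t e0 \<in> A)"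
    then have "verts (underlying G) \<subseteq> A"
      using connected_closed_verts[OF G r A(1)] A(2) by blast
    then show False using n tail_in_verts[OF e0(1)] by blast
  qed
  moreover have "h e0 x0 \<le> c (?s e0) + W e0" "h e0 x0 \<le> c (?t e0) + W e0"
    using W[OF e0, of 0] W[OF e0, of "len G e0"] c[OF e0(1)] l[OF e0(1)] by auto
  ultimately have "h e0 x0 - c r \<le> W e0 + (\<Sum>e\<in>?E - {e0}. W e)"
    using A(3)[of "?s e0"] A(3)[of "?t e0"] by linarith
  then show ?thesis using e0 by (simp add: sum.remove[of ?E e0])
qed

section \<open>Edgewise C^1 functions, regularity of eigenfunctions, Green's formula\<close>

definition edgewise_C1 ::
    "('v, 'e) metric_graph \<Rightarrow> ('e \<Rightarrow> real \<Rightarrow> real) \<Rightarrow> ('e \<Rightarrow> real \<Rightarrow> real) \<Rightarrow> bool" where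
  "edgewise_C1 G f f' \<longleftrightarrow>
     (\<forall>e\<in>arcs (underlying G). continuous_on {0..len G e} (f' e) \<and>
       (\<forall>x\<in>{0..len G e}. (f e has_real_derivative f' e x) (at x within {0..len G e})))"

lemma edgewise_C1_continuous:
  "edgewise_C1 G f f' \<Longrightarrow> e \<in> arcs (underlying G) \<Longrightarrow> continuous_on {0..len G e} (f e)"
  by (auto simp: edgewise_C1_def intro!: DERIV_continuous_on)

lemma edgewise_C1_continuous_deriv:
  "edgewise_C1 G f f' \<Longrightarrow> e \<in> arcs (underlying G) \<Longrightarrow> continuous_on {0..len G e} (f' e)"
  by (auto simp: edgewise_C1_def)

lemma edgewise_C1_deriv:
  "edgewise_C1 G f f' \<Longrightarrow> e \<in> arcs (underlying G) \<Longrightarrow> x \<in> {0..len G e} \<Longrightarrow>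
   (f e has_real_derivative f' e x) (at x within {0..len G e})"
  by (auto simp: edgewise_C1_def)

lemma edgewise_C1_L2: "edgewise_C1 G f f' \<Longrightarrow> f \<in> L2 G" "edgewise_C1 G f f' \<Longrightarrow> f' \<in> L2 G"
  by (auto simp: L2_def intro!: L2_interval_continuous
      dest: edgewise_C1_continuous edgewise_C1_continuous_deriv)

lemma edgewise_C1_cmult:
  "edgewise_C1 G f f' \<Longrightarrow> edgewise_C1 G (\<lambda>e x. c * f e x) (\<lambda>e x. c * f' e x)"
  by (auto simp: edgewise_C1_def intro!: continuous_intros DERIV_cmult)

lemma edgewise_C1_sum:
  assumes "\<And>i. i \<in> A \<Longrightarrow> edgewise_C1 G (F i) (F' i)"
  shows "edgewise_C1 G (\<lambda>e x. \<Sum>i\<in>A. F i e x) (\<lambda>e x. \<Sum>i\<in>A. F' i e x)"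
  using assms by (auto simp: edgewise_C1_def intro!: continuous_intros DERIV_sum)

lemma vertex_conditions_sum:
  assumes "\<And>i. i \<in> A \<Longrightarrow> vertex_conditions G (F i)"
  shows "vertex_conditions G (\<lambda>e x. \<Sum>i\<in>A. (a i :: real) * F i e x)"
proof -
  have "\<forall>i\<in>A. \<exists>c. (\<forall>e\<in>arcs (underlying G).
             F i e 0 = c (tail (underlying G) e) \<and> F i e (len G e) = c (head (underlying G) e)) \<and>
          (\<forall>v\<in>dirichlet_verts G. c v = 0)"
    using assms unfolding vertex_conditions_def by blast
  from bchoice[OF this] obtain c where c: "\<And>i. i \<in> A \<Longrightarrow> (\<forall>e\<in>arcs (underlying G).
             F i e 0 = c i (tail (underlying G) e) \<and> F i e (len G e) = c i (head (underlying G) e)) \<and>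
          (\<forall>v\<in>dirichlet_verts G. c i v = 0)"
    by blast
  then show ?thesis unfolding vertex_conditions_def
    by (intro exI[of _ "\<lambda>v. \<Sum>i\<in>A. a i * c i v"]) (auto intro!: sum.cong)
qed

lemma lebesgue_on_integral_continuous:
  fixes f :: "real \<Rightarrow> real"
  assumes "continuous_on {a..b} f"
  shows "integral\<^sup>L (lebesgue_on {a..b}) f = integral {a..b} f"
  by (intro lebesgue_integral_eq_integral continuous_imp_integrable_real assms) auto

lemma graph_integral_continuous:
  assumes "\<And>e. e \<in> arcs (underlying G) \<Longrightarrow> continuous_on {0..len G e} (f e)"
  shows "graph_integral G f = (\<Sum>e\<in>arcs (underlying G). integral {0..len G e} (f e))"
  using assms by (auto simp: graph_integral_def lebesgue_on_integral_continuous intro!: sum.cong)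

lemma has_integral_derivative:
  fixes F :: "real \<Rightarrow> real"
  assumes "a \<le> b" "\<And>x. x \<in> {a..b} \<Longrightarrow> (F has_real_derivative f x) (at x within {a..b})"
  shows "(f has_integral F b - F a) {a..b}"
  using assms
  by (intro fundamental_theorem_of_calculus) (auto simp: has_real_derivative_iff_has_vector_derivative[symmetric])

text \<open>Bootstrapping: the weak second derivative is a multiple of the eigenfunction, which is
  continuous, so the integral identity for \<open>f'\<close> can be differentiated at every point.
  From here on Riemann integrals and the fundamental theorem of calculus suffice.\<close>

lemma eigenfunction_classical:
  assumes G: "compact_metric_graph G" and lap: "neg_laplacian G f (\<lambda>e x. l * f e x)"
  obtains f' where "edgewise_C1 G f f'" "edgewise_C1 G f' (\<lambda>e x. - (l * f e x))"
    "vertex_conditions G f" "kirchhoff_condition G f'"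
proof -
  obtain f' where f': "\<forall>e\<in>arcs (underlying G). H2_interval (len G e) (f e) (f' e) (\<lambda>x. - (l * f e x))"
     and vk: "vertex_conditions G f" "kirchhoff_condition G f'"
    using lap unfolding neg_laplacian_def by auto
  have cf: "continuous_on {0..len G e} (f e)" if "e \<in> arcs (underlying G)" for e
    using f' that unfolding H2_interval_def by (intro DERIV_continuous_on) blast
  have df': "(f' e has_real_derivative - (l * f e x)) (at x within {0..len G e})"
    if e: "e \<in> arcs (underlying G)" and x: "x \<in> {0..len G e}" for e x
  proof -
    let ?g = "\<lambda>x. - (l * f e x)"
    have cg: "continuous_on {0..len G e} ?g" by (intro continuous_intros cf e)
    have eq: "f' e y = f' e 0 + integral {0..y} ?g" if "y \<in> {0..len G e}" for y
    proof -
      have "continuous_on {0..y} ?g" by (rule continuous_on_subset[OF cg]) (use that in auto)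
      moreover have "f' e y = f' e 0 + integral\<^sup>L (lebesgue_on {0..y}) ?g"
        using f' e that unfolding H2_interval_def by blast
      ultimately show ?thesis using lebesgue_on_integral_continuous by metis
    qed
    have "((\<lambda>y. f' e 0 + integral {0..y} ?g) has_real_derivative 0 + ?g x) (at x within {0..len G e})"
      by (intro DERIV_add DERIV_const integral_has_real_derivative cg x)
    then have "((\<lambda>y. f' e 0 + integral {0..y} ?g) has_real_derivative ?g x) (at x within {0..len G e})"
      by simp
    then show ?thesis
      by (rule has_field_derivative_transform_within[OF _ zero_less_one x]) (rule eq[symmetric])
  qed
  have "continuous_on {0..len G e} (f' e)" if "e \<in> arcs (underlying G)" for e
    using df'[OF that] by (rule DERIV_continuous_on)
  then have "edgewise_C1 G f f'"
    using f' unfolding edgewise_C1_def H2_interval_def by blast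
  moreover have "edgewise_C1 G f' (\<lambda>e x. - (l * f e x))"
    unfolding edgewise_C1_def by (intro ballI conjI continuous_intros cf df')
  ultimately show thesis using that vk by blast
qed

text \<open>Integration by parts on each edge, with the boundary terms regrouped by vertex. At a
  Dirichlet vertex the value of \<open>h\<close> is 0; at any other vertex the common value of
  \<open>h\<close> factors out and leaves the Kirchhoff sum of \<open>f'\<close>.\<close>

lemma Green:
  fixes G :: "('v, 'e) metric_graph"
  assumes G: "compact_metric_graph G"
    and f: "edgewise_C1 G f f'" "edgewise_C1 G f' (\<lambda>e x. - g e x)" "kirchhoff_condition G f'"
    and h: "edgewise_C1 G h h'" "vertex_conditions G h"
  shows "L2_inner G g h = L2_inner G f' h'"
proof -
  let ?E = "arcs (underlying G)" and ?V = "verts (underlying G)"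
  let ?s = "tail (underlying G)" and ?t = "head (underlying G)"
  interpret fin_digraph "underlying G" using G by (simp add: compact_metric_graph_def)
  have l: "0 \<le> len G e" if "e \<in> ?E" for e
    using G that by (auto simp: compact_metric_graph_def)
  obtain c where c: "\<And>e. e \<in> ?E \<Longrightarrow> h e 0 = c (?s e) \<and> h e (len G e) = c (?t e)"
      "\<And>v. v \<in> dirichlet_verts G \<Longrightarrow> c v = 0"
    using h(2) unfolding vertex_conditions_def by auto
  have g: "continuous_on {0..len G e} (g e)" if "e \<in> ?E" for e
    using continuous_on_minus[OF edgewise_C1_continuous_deriv[OF f(2) that]] by simp
  note cont = g edgewise_C1_continuous_deriv[OF f(1)] edgewise_C1_continuous[OF h(1)]
    edgewise_C1_continuous_deriv[OF h(1)]
  have e: "integral {0..len G e} (\<lambda>x. f' e x * h' e x) - integral {0..len G e} (\<lambda>x. g e x * h e x)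
      = f' e (len G e) * c (?t e) + - f' e 0 * c (?s e)" if "e \<in> ?E" for e
  proof -
    have "((\<lambda>x. f' e x * h' e x + - g e x * h e x) has_integral
        f' e (len G e) * h e (len G e) - f' e 0 * h e 0) {0..len G e}"
      by (intro has_integral_derivative l that)
         (auto intro!: derivative_eq_intros edgewise_C1_deriv[OF f(2)] edgewise_C1_deriv[OF h(1)] that)
    then have "integral {0..len G e} (\<lambda>x. f' e x * h' e x - g e x * h e x)
        = f' e (len G e) * c (?t e) - f' e 0 * c (?s e)"
      using c(1)[OF that] by (simp add: integral_unique)
    moreover have "integral {0..len G e} (\<lambda>x. f' e x * h' e x - g e x * h e x)
      = integral {0..len G e} (\<lambda>x. f' e x * h' e x) - integral {0..len G e} (\<lambda>x. g e x * h e x)"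
      by (intro Henstock_Kurzweil_Integration.integral_diff integrable_continuous_real continuous_intros cont that)
    ultimately show ?thesis by simp
  qed
  have "L2_inner G f' h' - L2_inner G g h = (\<Sum>e\<in>?E. f' e (len G e) * c (?t e) + - f' e 0 * c (?s e))"
    unfolding L2_inner_def
    by (subst (1 2) graph_integral_continuous)
       (auto intro!: continuous_intros cont sum.cong simp: sum_subtractf[symmetric] e)
  also have "\<dots> = (\<Sum>e\<in>?E. f' e (len G e) * c (?t e)) + (\<Sum>e\<in>?E. - f' e 0 * c (?s e))"
    by (rule sum.distrib)
  \<comment> \<open>Edges are sorted by head here and by tail below, so a loop appears in both sums
    at the same vertex.\<close>
  also have "(\<Sum>e\<in>?E. f' e (len G e) * c (?t e)) = (\<Sum>v\<in>?V. \<Sum>e\<in>{e\<in>?E. ?t e = v}. f' e (len G e) * c (?t e))"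
    by (rule sum.group[symmetric]) auto
  also have "(\<Sum>e\<in>?E. - f' e 0 * c (?s e)) = (\<Sum>v\<in>?V. \<Sum>e\<in>{e\<in>?E. ?s e = v}. - f' e 0 * c (?s e))"
    by (rule sum.group[symmetric]) auto
  also have "(\<Sum>v\<in>?V. \<Sum>e\<in>{e\<in>?E. ?t e = v}. f' e (len G e) * c (?t e))
      + (\<Sum>v\<in>?V. \<Sum>e\<in>{e\<in>?E. ?s e = v}. - f' e 0 * c (?s e))
      = (\<Sum>v\<in>?V. c v * ((\<Sum>e\<in>{e\<in>?E. ?t e = v}. f' e (len G e)) + (\<Sum>e\<in>{e\<in>?E. ?s e = v}. - f' e 0)))"
    unfolding sum.distrib[symmetric] distrib_left sum_distrib_left
    by (intro sum.cong arg_cong2[where f = "(+)"]) auto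
  also have "\<dots> = 0"
  proof (intro sum.neutral ballI)
    fix v assume v: "v \<in> ?V"
    show "c v * ((\<Sum>e\<in>{e\<in>?E. ?t e = v}. f' e (len G e)) + (\<Sum>e\<in>{e\<in>?E. ?s e = v}. - f' e 0)) = 0"
    proof (cases "v \<in> dirichlet_verts G")
      case False
      with v have "v \<in> ?V - dirichlet_verts G" by simp
      then show ?thesis using f(3) unfolding kirchhoff_condition_def by simp
    qed (simp add: c(2))
  qed
  finally show ?thesis by simp
qed

section \<open>Slopes of the torsion function of an interval\<close>

text \<open>Concavity of \<open>tanh\<close> on the nonnegative half-line: its derivative
  \<open>1 - (tanh z)\<^sup>2\<close> decreases there.\<close>

lemma tanh_le_tangent:
  fixes x y :: real
  assumes "0 \<le> x" "0 \<le> y"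
  shows "tanh x \<le> tanh y + (1 - (tanh y)\<^sup>2) * (x - y)"
proof -
  have D: "((\<lambda>x. tanh x) has_real_derivative 1 - (tanh z)\<^sup>2) (at z)" for z :: real
    by (auto intro!: derivative_eq_intros)
  consider "x = y" | "x < y" | "y < x" by linarith
  then show ?thesis
  proof cases
    case 2
    then obtain z where z: "x < z" "z < y" "tanh y - tanh x = (y - x) * (1 - (tanh z)\<^sup>2)"
      using MVT2[of x y tanh "\<lambda>z. 1 - (tanh z)\<^sup>2"] D by auto
    have "(tanh z)\<^sup>2 \<le> (tanh y)\<^sup>2"
      using z assms by (intro power_mono) auto
    then have "(y - x) * (1 - (tanh y)\<^sup>2) \<le> (y - x) * (1 - (tanh z)\<^sup>2)"
      using 2 by (intro mult_left_mono) auto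
    then show ?thesis using z(3) by (simp add: algebra_simps)
  next
    case 3
    then obtain z where z: "y < z" "z < x" "tanh x - tanh y = (x - y) * (1 - (tanh z)\<^sup>2)"
      using MVT2[of y x tanh "\<lambda>z. 1 - (tanh z)\<^sup>2"] D by auto
    have "(tanh y)\<^sup>2 \<le> (tanh z)\<^sup>2"
      using z assms by (intro power_mono) auto
    then have "(x - y) * (1 - (tanh z)\<^sup>2) \<le> (x - y) * (1 - (tanh y)\<^sup>2)"
      using 3 by (intro mult_left_mono) auto
    then show ?thesis using z(3) by (simp add: algebra_simps)
  qed auto
qed

section \<open>Oscillation on an edge and extrema on the graph\<close>

lemma C1_oscillation:
  fixes F :: "real \<Rightarrow> real"
  assumes F: "\<And>x. x \<in> {a..b} \<Longrightarrow> (F has_real_derivative F' x) (at x within {a..b})"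
    and F': "continuous_on {a..b} F'" and "x \<in> {a..b}" "y \<in> {a..b}"
  shows "\<bar>F x - F y\<bar> \<le> integral {a..b} (\<lambda>t. \<bar>F' t\<bar>)"
proof -
  have *: "\<bar>F y - F x\<bar> \<le> integral {a..b} (\<lambda>t. \<bar>F' t\<bar>)" if "x \<in> {a..b}" "y \<in> {a..b}" "x \<le> y" for x y
  proof -
    have sub: "{x..y} \<subseteq> {a..b}" using that by auto
    have i: "F' integrable_on {x..y}" "(\<lambda>t. \<bar>F' t\<bar>) integrable_on {x..y}" "(\<lambda>t. \<bar>F' t\<bar>) integrable_on {a..b}"
      by (intro integrable_continuous_real continuous_intros continuous_on_subset[OF F'] sub subset_refl)+
    have "(F' has_integral F y - F x) {x..y}"
      using that sub by (intro has_integral_derivative DERIV_subset[OF F]) auto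
    then have "\<bar>F y - F x\<bar> = \<bar>integral {x..y} F'\<bar>" by (simp add: integral_unique)
    also have "\<dots> \<le> integral {x..y} (\<lambda>t. \<bar>F' t\<bar>)"
      using Henstock_Kurzweil_Integration.integral_norm_bound_integral[OF i(1,2)] by simp
    also have "\<dots> \<le> integral {a..b} (\<lambda>t. \<bar>F' t\<bar>)"
      by (rule integral_subset_le[OF sub i(2,3)]) auto
    finally show ?thesis .
  qed
  show ?thesis
    using *[of x y] *[of y x] assms(3,4) by (cases "x \<le> y") (auto simp: abs_minus_commute)
qed

lemma graph_attains_sup:
  fixes G :: "('v, 'e) metric_graph"
  assumes G: "compact_metric_graph G" and ne: "arcs (underlying G) \<noteq> {}"
    and cont: "\<And>e. e \<in> arcs (underlying G) \<Longrightarrow> continuous_on {0..len G e} (f e :: real \<Rightarrow> real)"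
  obtains e0 x0 where "e0 \<in> arcs (underlying G)" "x0 \<in> {0..len G e0}"
    "\<And>e x. e \<in> arcs (underlying G) \<Longrightarrow> x \<in> {0..len G e} \<Longrightarrow> f e x \<le> f e0 x0"
proof -
  let ?E = "arcs (underlying G)"
  interpret fin_digraph "underlying G" using G by (simp add: compact_metric_graph_def)
  have "\<forall>e\<in>?E. \<exists>x\<in>{0..len G e}. \<forall>y\<in>{0..len G e}. f e y \<le> f e x"
    using G cont by (intro ballI continuous_attains_sup) (auto simp: compact_metric_graph_def intro: less_imp_le)
  then obtain X where X: "\<forall>e\<in>?E. X e \<in> {0..len G e} \<and> (\<forall>y\<in>{0..len G e}. f e y \<le> f e (X e))"
    using bchoice[of ?E "\<lambda>e x. x \<in> {0..len G e} \<and> (\<forall>y\<in>{0..len G e}. f e y \<le> f e x)"] by blast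
  have "Max ((\<lambda>e. f e (X e)) ` ?E) \<in> (\<lambda>e. f e (X e)) ` ?E"
    using ne by (intro Max_in) auto
  then obtain e0 where e0: "e0 \<in> ?E" "Max ((\<lambda>e. f e (X e)) ` ?E) = f e0 (X e0)" by blast
  show thesis
  proof (rule that[of e0 "X e0"])
    fix e x assume ex: "e \<in> ?E" "x \<in> {0..len G e}"
    then have "f e x \<le> f e (X e)" using X by blast
    also have "\<dots> \<le> Max ((\<lambda>e. f e (X e)) ` ?E)" using ex by (intro Max_ge) auto
    finally show "f e x \<le> f e0 (X e0)" using e0(2) by simp
  qed (use X e0 in auto)
qed

text \<open>Otherwise \<open>{r}\<close> would be closed, hence the whole vertex set, and the tail
  of any edge would be \<open>r\<close>. It serves to show that the Dirichlet condition at
  \<open>r\<close> is really seen by a function on the edges.\<close>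

lemma incident_edge:
  fixes G :: "('v, 'e) metric_graph"
  assumes G: "compact_metric_graph G" "connected_metric_graph G" and ne: "arcs (underlying G) \<noteq> {}"
    and r: "r \<in> verts (underlying G)"
  obtains e where "e \<in> arcs (underlying G)" "tail (underlying G) e = r \<or> head (underlying G) e = r"
proof (rule ccontr)
  assume n: "\<not> thesis"
  interpret fin_digraph "underlying G" using G by (simp add: compact_metric_graph_def)
  have "verts (underlying G) \<subseteq> {r}"
    by (rule connected_closed_verts[OF G r]) (use n that in auto)
  then show False using ne n that tail_in_verts by blast
qed

text \<open>
  \<open>slope s c t\<close> is the derivative, at the point where it takes the value \<open>t\<close>, of the solution of
  \<open>- u'' + s * u = 1\<close> with \<open>u(0) = 0\<close> and maximum \<open>(1 - c) / s\<close> attained at a Neumann end.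
\<close>

definition slope :: "real \<Rightarrow> real \<Rightarrow> real \<Rightarrow> real" where
  "slope s c t = sqrt (max 0 ((1 - s * t)\<^sup>2 - c\<^sup>2)) / sqrt s"

lemma slope_nonneg: "0 \<le> s \<Longrightarrow> 0 \<le> slope s c t"
  by (simp add: slope_def)

lemma continuous_on_slope: "continuous_on A (slope s c)"
  unfolding slope_def[abs_def] divide_inverse by (intro continuous_intros)

text \<open>Conservation of energy: along a solution of \<open>- u'' + s * u = 1\<close> the
  quantity \<open>2 * u - s * u\<^sup>2 + u'\<^sup>2\<close> is constant, and its value is read off
  at the maximum \<open>(1 - c) / s\<close>, where \<open>u' = 0\<close>.\<close>

lemma slope_power2:
  assumes "0 < s" "c\<^sup>2 \<le> (1 - s * t)\<^sup>2"
  shows "2 * t - s * t\<^sup>2 + (slope s c t)\<^sup>2 = (1 - c\<^sup>2) / s"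
  using assms by (simp add: slope_def power_divide max_def field_simps power2_eq_square)

text \<open>The substitution \<open>w = 1 - s * t\<close> reduces this to the integral of
  \<open>sqrt (w\<^sup>2 - c\<^sup>2)\<close> over \<open>{c..1}\<close>. The logarithm is
  \<open>arcosh (1 / c)\<close>, that is, \<open>sqrt s\<close> times the length of the calibrating
  interval.\<close>

lemma has_integral_slope:
  assumes s: "0 < s" and c: "0 < c" "c \<le> 1"
  defines "\<tau> \<equiv> sqrt (1 - c\<^sup>2)"
  shows "(slope s c has_integral (\<tau> - c\<^sup>2 * ln ((1 + \<tau>) / c)) / (2 * s * sqrt s)) {0..(1 - c) / s}"
proof -
  define P where "P w = w * sqrt (w\<^sup>2 - c\<^sup>2) - c\<^sup>2 * ln (w + sqrt (w\<^sup>2 - c\<^sup>2))" for w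
  have DP: "(P has_real_derivative 2 * sqrt (w\<^sup>2 - c\<^sup>2)) (at w)" if w: "c < w" for w
  proof -
    define \<rho> where "\<rho> = sqrt (w\<^sup>2 - c\<^sup>2)"
    have "c\<^sup>2 < w\<^sup>2" using w c by (intro power_strict_mono) auto
    then have \<rho>: "0 < \<rho>" "\<rho>\<^sup>2 = w\<^sup>2 - c\<^sup>2" by (auto simp: \<rho>_def)
    have d: "(P has_real_derivative \<rho> + w * (w / \<rho>) - c\<^sup>2 * ((1 + w / \<rho>) / (w + \<rho>))) (at w)"
      unfolding P_def[abs_def]
      using \<rho> c w \<open>c\<^sup>2 < w\<^sup>2\<close>
      by (auto intro!: derivative_eq_intros simp: \<rho>_def[symmetric]) (simp add: field_simps)
    have e: "\<rho> + w * (w / \<rho>) - c\<^sup>2 * ((1 + w / \<rho>) / (w + \<rho>)) = 2 * \<rho>"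
    proof -
      have "1 + w / \<rho> = (w + \<rho>) / \<rho>" "w + \<rho> \<noteq> 0"
        using \<rho>(1) w c by (auto simp: field_simps)
      then have eq: "(1 + w / \<rho>) / (w + \<rho>) = 1 / \<rho>" by simp
      have "\<rho> + w * (w / \<rho>) - c\<^sup>2 * ((1 + w / \<rho>) / (w + \<rho>)) = (\<rho>\<^sup>2 + (w\<^sup>2 - c\<^sup>2)) / \<rho>"
        unfolding eq using \<rho>(1) by (simp add: field_simps power2_eq_square)
      also have "\<dots> = 2 * \<rho>"
        unfolding \<rho>(2)[symmetric] using \<rho>(1) by (simp add: power2_eq_square)
      finally show ?thesis .
    qed
    show ?thesis using d unfolding e unfolding \<rho>_def .
  qed
  have le: "0 \<le> (1 - c) / s" using s c by simp
  have w: "c \<le> 1 - s * t" if "t \<in> {0..(1 - c) / s}" for t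
    using that s by (auto simp: field_simps)
  have w': "c < 1 - s * t" if "t \<in> {0<..<(1 - c) / s}" for t
    using that s by (auto simp: field_simps)
  define Q where "Q t = - P (1 - s * t) / (2 * s * sqrt s)" for t
  have "(slope s c has_integral Q ((1 - c) / s) - Q 0) {0..(1 - c) / s}"
  \<comment> \<open>The square root vanishes at the right end and is not differentiable there, so
    the end points are covered by continuity only.\<close>
  proof (rule fundamental_theorem_of_calculus_interior[OF le])
    have "\<And>t. t \<in> {0..(1 - c) / s} \<Longrightarrow> 1 - s * t + sqrt ((1 - s * t)\<^sup>2 - c\<^sup>2) \<noteq> 0"
    proof -
      fix t assume "t \<in> {0..(1 - c) / s}"
      then have "c \<le> 1 - s * t" by (rule w)
      moreover from this have "0 \<le> sqrt ((1 - s * t)\<^sup>2 - c\<^sup>2)"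
        using c by (simp add: power_mono)
      ultimately show "1 - s * t + sqrt ((1 - s * t)\<^sup>2 - c\<^sup>2) \<noteq> 0" using c by linarith
    qed
    then show "continuous_on {0..(1 - c) / s} Q"
      unfolding Q_def[abs_def] P_def using s by (intro continuous_intros) auto
    fix t assume t: "t \<in> {0<..<(1 - c) / s}"
    have "c\<^sup>2 \<le> (1 - s * t)\<^sup>2" using w'[OF t] c by (intro power_mono) auto
    then have sl: "slope s c t = sqrt ((1 - s * t)\<^sup>2 - c\<^sup>2) / sqrt s" by (simp add: slope_def)
    have "((\<lambda>t. P (1 - s * t)) has_real_derivative 2 * sqrt ((1 - s * t)\<^sup>2 - c\<^sup>2) * (- s)) (at t)"
      by (rule DERIV_chain2[where f = P and g = "\<lambda>t. 1 - s * t", OF DP[OF w'[OF t]]]) (auto intro!: derivative_eq_intros)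
    then have "((\<lambda>t. - P (1 - s * t) / (2 * s * sqrt s)) has_real_derivative
        - (2 * sqrt ((1 - s * t)\<^sup>2 - c\<^sup>2) * (- s)) / (2 * s * sqrt s)) (at t)"
      by (intro DERIV_cdivide DERIV_minus)
    then have "(Q has_real_derivative slope s c t) (at t)"
      using s unfolding Q_def[abs_def] sl by (simp add: field_simps)
    then show "(Q has_vector_derivative slope s c t) (at t)"
      by (simp add: has_real_derivative_iff_has_vector_derivative)
  qed
  moreover have "Q ((1 - c) / s) - Q 0 = (\<tau> - c\<^sup>2 * ln ((1 + \<tau>) / c)) / (2 * s * sqrt s)"
  proof -
    have \<tau>: "0 \<le> \<tau>" using c by (simp add: \<tau>_def power_le_one)
    have "1 - s * ((1 - c) / s) = c" using s by simp
    then have "Q ((1 - c) / s) - Q 0 = (P 1 - P c) / (2 * s * sqrt s)"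
      by (simp only: Q_def) (simp add: diff_divide_distrib)
    also have "P 1 - P c = \<tau> - c\<^sup>2 * ln ((1 + \<tau>) / c)"
      using \<tau> c by (simp add: P_def \<tau>_def[symmetric] ln_div right_diff_distrib)
    finally show ?thesis .
  qed
  ultimately show ?thesis by simp
qed

text \<open>The limit of an infinitely long calibrating interval: on the half-line the solution is
  \<open>(1 - exp (- sqrt s * x)) / s\<close> and its slope is linear in its value. The logarithm of
  \<open>has_integral_slope\<close> degenerates here.\<close>

lemma has_integral_slope_0:
  assumes s: "0 < s"
  shows "(slope s 0 has_integral 1 / (2 * s * sqrt s)) {0..1 / s}"
proof -
  have "((\<lambda>t. (1 - s * t) / sqrt s) has_integral
      - (1 - s * (1 / s))\<^sup>2 / (2 * s * sqrt s) - - (1 - s * 0)\<^sup>2 / (2 * s * sqrt s)) {0..1 / s}"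
    using s by (intro has_integral_derivative) (auto intro!: derivative_eq_intros simp: field_simps power2_eq_square)
  moreover have "slope s 0 t = (1 - s * t) / sqrt s" if "t \<in> {0..1 / s}" for t
    using that s by (simp add: slope_def field_simps)
  ultimately show ?thesis using s
    by (subst has_integral_cong[of _ _ "\<lambda>t. (1 - s * t) / sqrt s"]) auto
qed

text \<open>
  For \<open>c = 1 / cosh (sqrt s * l)\<close> the left-hand side is the bound obtained by comparison with the
  interval of length \<open>l\<close>; that the right one is \<open>l = L\<close> is concavity of \<open>tanh\<close>.
\<close>

lemma slope_bound:
  assumes s: "0 < s" and L: "0 \<le> L" and c: "0 \<le> c" "c \<le> 1"
  shows "L * (1 - c\<^sup>2) / s - 2 * integral {0..(1 - c) / s} (slope s c)
    \<le> (L - tanh (sqrt s * L) / sqrt s) / s"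
proof (cases "c = 0")
  case True
  \<comment> \<open>For \<open>c = 0\<close> the left-hand side is
    \<open>(L - 1 / sqrt s) / s\<close>, so this bound is what remains of concavity.\<close>
  have "tanh (sqrt s * L) \<le> 1" using tanh_real_lt_1 by (simp add: less_imp_le)
  moreover have "integral {0..(1 - c) / s} (slope s c) = 1 / (2 * s * sqrt s)"
    using has_integral_slope_0[OF s] True by (simp add: integral_unique)
  ultimately show ?thesis using s True by (simp add: field_simps)
next
  case False
  with c have c0: "0 < c" by simp
  define \<tau> where "\<tau> = sqrt (1 - c\<^sup>2)"
  have \<tau>: "0 \<le> \<tau>" "\<tau>\<^sup>2 = 1 - c\<^sup>2" using c by (auto simp: \<tau>_def power_le_one)
  \<comment> \<open>\<open>Y\<close> is \<open>sqrt s * l\<close> for the calibrating length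
    \<open>l\<close>, so that \<open>cosh Y = 1 / c\<close> and
    \<open>tanh Y = \<tau>\<close>.\<close>
  define Y where "Y = ln ((1 + \<tau>) / c)"
  have pos: "0 < (1 + \<tau>) / c" using \<tau> c0 by simp
  have "((1 + \<tau>) / c)\<^sup>2 = (1 + \<tau>)\<^sup>2 / (1 - \<tau>\<^sup>2)" using \<tau> by (simp add: power_divide)
  then have "tanh Y = ((1 + \<tau>)\<^sup>2 / (1 - \<tau>\<^sup>2) - 1) / ((1 + \<tau>)\<^sup>2 / (1 - \<tau>\<^sup>2) + 1)"
    unfolding Y_def using tanh_ln_real[OF pos] by simp
  also have "\<dots> = \<tau>"
  proof -
    have a: "0 < 1 - \<tau>\<^sup>2" using \<tau> c0 by simp
    have "((1 + \<tau>)\<^sup>2 / (1 - \<tau>\<^sup>2) - 1) / ((1 + \<tau>)\<^sup>2 / (1 - \<tau>\<^sup>2) + 1)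
        = ((1 + \<tau>)\<^sup>2 - (1 - \<tau>\<^sup>2)) / ((1 + \<tau>)\<^sup>2 + (1 - \<tau>\<^sup>2))"
    proof -
      have "x / y - 1 = (x - y) / y" "x / y + 1 = (x + y) / y" if "y \<noteq> 0" for x y :: real
        using that by (auto simp: field_simps)
      then show ?thesis using a by simp
    qed
    also have "(1 + \<tau>)\<^sup>2 - (1 - \<tau>\<^sup>2) = \<tau> * (2 * (1 + \<tau>))"
      by (simp add: power2_eq_square algebra_simps)
    also have "(1 + \<tau>)\<^sup>2 + (1 - \<tau>\<^sup>2) = 2 * (1 + \<tau>)"
      by (simp add: power2_eq_square algebra_simps)
    finally show ?thesis using \<tau> by simp
  qed
  finally have tY: "tanh Y = \<tau>" .
  then have Y: "0 \<le> Y" using \<tau> by (metis tanh_real_nonneg_iff)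
  have k: "0 < sqrt s" using s by simp
  have int: "integral {0..(1 - c) / s} (slope s c) = (\<tau> - c\<^sup>2 * Y) / (2 * s * sqrt s)"
    using has_integral_slope[OF s c0 c(2)] by (simp add: integral_unique \<tau>_def Y_def)
  \<comment> \<open>The tangent at \<open>Y\<close> has slope
    \<open>1 - \<tau>\<^sup>2 = c\<^sup>2\<close>, precisely the coefficient that \<open>L\<close>
    needs.\<close>
  have "tanh (sqrt s * L) \<le> \<tau> + c\<^sup>2 * (sqrt s * L - Y)"
    using tanh_le_tangent[of "sqrt s * L" Y] Y L s \<tau> by (simp add: tY)
  then have "tanh (sqrt s * L) / sqrt s \<le> (\<tau> + c\<^sup>2 * (sqrt s * L - Y)) / sqrt s"
    using k by (intro divide_right_mono) auto
  also have "\<dots> = c\<^sup>2 * L + (\<tau> - c\<^sup>2 * Y) / sqrt s"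
    using k by (simp add: field_simps)
  finally have "L * (1 - c\<^sup>2) - (\<tau> - c\<^sup>2 * Y) / sqrt s \<le> L - tanh (sqrt s * L) / sqrt s"
    by (simp add: algebra_simps)
  then have "(L * (1 - c\<^sup>2) - (\<tau> - c\<^sup>2 * Y) / sqrt s) / s \<le> (L - tanh (sqrt s * L) / sqrt s) / s"
    using s by (intro divide_right_mono) auto
  then show ?thesis unfolding int using s by (simp add: diff_divide_distrib mult.commute[of s])
qed

section \<open>Bound on the resolvent\<close>

text \<open>
  With \<open>q = slope s c\<close>, where \<open>(1 - c) / s\<close> is the smaller of \<open>1 / s\<close> and the maximum of \<open>f\<close>,
  Young's inequality \<open>f'\<^sup>2 \<ge> 2 * q f * \<bar>f'\<bar> - (q f)\<^sup>2\<close> makes the terms without derivative constant,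
  and the integral of \<open>q f * \<bar>f'\<bar>\<close> is at least the oscillation of a primitive of \<open>q\<close> along \<open>f\<close>.
\<close>

lemma energy_bound:
  fixes G :: "('v, 'e) metric_graph"
  assumes G: "compact_metric_graph G" "connected_metric_graph G" and D: "dirichlet_verts G \<noteq> {}"
    and ne: "arcs (underlying G) \<noteq> {}" and s: "0 < s"
    and f: "edgewise_C1 G f f'" "vertex_conditions G f"
  shows "2 * graph_integral G f - s * L2_inner G f f - L2_inner G f' f'
    \<le> (total_length G - tanh (sqrt s * total_length G) / sqrt s) / s"
proof -
  let ?E = "arcs (underlying G)" and ?s = "tail (underlying G)" and ?t = "head (underlying G)"
  interpret fin_digraph "underlying G" using G by (simp add: compact_metric_graph_def)
  have l: "0 < len G e" if "e \<in> ?E" for e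
    using G that by (auto simp: compact_metric_graph_def)
  obtain cv where cv: "\<And>e. e \<in> ?E \<Longrightarrow> f e 0 = cv (?s e) \<and> f e (len G e) = cv (?t e)"
      "\<And>v. v \<in> dirichlet_verts G \<Longrightarrow> cv v = 0"
    using f(2) unfolding vertex_conditions_def by auto
  obtain r where rD: "r \<in> dirichlet_verts G" using D by auto
  have r: "r \<in> verts (underlying G)" using rD G by (auto simp: compact_metric_graph_def)
  note cf = edgewise_C1_continuous[OF f(1)] and cf' = edgewise_C1_continuous_deriv[OF f(1)]
  obtain e0 x0 where e0: "e0 \<in> ?E" "x0 \<in> {0..len G e0}"
      "\<And>e x. e \<in> ?E \<Longrightarrow> x \<in> {0..len G e} \<Longrightarrow> f e x \<le> f e0 x0"
    using graph_attains_sup[OF G(1) ne cf] by blast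
  have "continuous_on {0..len G e} (\<lambda>x. - f e x)" if "e \<in> ?E" for e
    by (intro continuous_intros cf that)
  then obtain e1 x1 where e1: "e1 \<in> ?E" "x1 \<in> {0..len G e1}"
      "\<And>e x. e \<in> ?E \<Longrightarrow> x \<in> {0..len G e} \<Longrightarrow> - f e x \<le> - f e1 x1"
    using graph_attains_sup[OF G(1) ne, of "\<lambda>e x. - f e x"] by blast
  define m where "m = f e0 x0"
  define a where "a = f e1 x1"
  have range: "f e x \<in> {a..m}" if "e \<in> ?E" "x \<in> {0..len G e}" for e x
    using e0(3)[OF that] e1(3)[OF that] by (auto simp: m_def a_def)
  obtain er where er: "er \<in> ?E" "?s er = r \<or> ?t er = r"
    using incident_edge[OF G ne r] by blast
  \<comment> \<open>An edge at the Dirichlet vertex \<open>r\<close> shows that \<open>f\<close>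
    takes the value 0; hence \<open>m\<close> is nonnegative and \<open>c\<close> at most 1.\<close>
  have zero: "0 \<in> {a..m}"
    using er(2) range[OF er(1), of 0] range[OF er(1), of "len G er"] cv(1)[OF er(1)] cv(2)[OF rD] l[OF er(1)]
    by auto
  define c where "c = max 0 (1 - s * m)"
  have c: "0 \<le> c" "c \<le> 1" using zero s by (auto simp: c_def)
  \<comment> \<open>The truncation in \<open>c\<close> keeps this true when \<open>m\<close> exceeds
    \<open>1 / s\<close>, so \<open>slope_power2\<close> applies at every value of \<open>f\<close>,
    negative ones included.\<close>
  have c2: "c\<^sup>2 \<le> (1 - s * t)\<^sup>2" if "t \<le> m" for t
  proof (cases "c = 0")
    case False
    then have "c = 1 - s * m" by (auto simp: c_def)
    moreover have "s * t \<le> s * m" using s that by simp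
    ultimately show ?thesis using c by (intro power_mono) auto
  qed simp
  have cm: "(1 - c) / s \<le> m"
    using s by (auto simp: c_def field_simps max_def)
  define q where "q = slope s c"
  have q0: "0 \<le> q t" for t using slope_nonneg s by (simp add: q_def)
  have cq: "continuous_on A q" for A by (simp add: q_def continuous_on_slope)
  \<comment> \<open>The base point is the minimum \<open>a\<close>, because \<open>f\<close> may be
    negative and \<open>Q\<close> must be differentiable on the whole range of \<open>f\<close>;
    only differences of \<open>Q\<close> matter.\<close>
  define Q where "Q t = integral {a..t} q" for t
  have DQ: "(Q has_real_derivative q t) (at t within {a..m})" if "t \<in> {a..m}" for t
    unfolding Q_def by (rule integral_has_real_derivative[OF cq that])
  have Qf: "((\<lambda>x. Q (f e x)) has_real_derivative q (f e x) * f' e x) (at x within {0..len G e})"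
    if ex: "e \<in> ?E" "x \<in> {0..len G e}" for e x
  proof -
    have "(Q has_real_derivative q (f e x)) (at (f e x) within f e ` {0..len G e})"
      by (rule DERIV_subset[OF DQ[OF range[OF ex]]]) (use range ex in auto)
    from DERIV_image_chain[OF this edgewise_C1_deriv[OF f(1) ex]] show ?thesis by (simp add: o_def)
  qed
  have cqf: "continuous_on {0..len G e} (\<lambda>x. q (f e x))" if "e \<in> ?E" for e
    by (rule continuous_on_compose2[OF cq[of UNIV] cf[OF that]]) auto
  define W where "W e = integral {0..len G e} (\<lambda>x. \<bar>q (f e x) * f' e x\<bar>)" for e
  have "Q (f e0 x0) - Q (cv r) \<le> (\<Sum>e\<in>?E. W e)"
  proof (rule graph_oscillation_le[OF G r, where h = "\<lambda>e x. Q (f e x)" and c = "\<lambda>v. Q (cv v)"])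
    show "Q (f e 0) = Q (cv (?s e)) \<and> Q (f e (len G e)) = Q (cv (?t e))" if "e \<in> ?E" for e
      using cv(1)[OF that] by simp
    show "\<bar>Q (f e x) - Q (f e y)\<bar> \<le> W e" if "e \<in> ?E" "x \<in> {0..len G e}" "y \<in> {0..len G e}" for e x y
      unfolding W_def using that
      by (intro C1_oscillation Qf continuous_intros cqf cf') auto
  qed (use e0 in auto)
  \<comment> \<open>Equality when \<open>m\<close> is at most \<open>1 / s\<close>; for larger
    \<open>m\<close> the range above \<open>1 / s\<close> is dropped, as \<open>q\<close> is
    nonnegative.\<close>
  moreover have "integral {0..(1 - c) / s} q \<le> Q m - Q 0"
  proof -
    have "Q m = Q 0 + integral {0..m} q"
      unfolding Q_def using zero
      by (intro Henstock_Kurzweil_Integration.integral_combine[symmetric] integrable_continuous_real cq) auto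
    moreover have "integral {0..(1 - c) / s} q \<le> integral {0..m} q"
      using cm q0 by (intro integral_subset_le integrable_continuous_real cq) auto
    ultimately show ?thesis by simp
  qed
  ultimately have W: "integral {0..(1 - c) / s} q \<le> (\<Sum>e\<in>?E. W e)"
    using cv(2)[OF rD] by (simp add: m_def)
  have edge: "2 * integral {0..len G e} (f e) - s * integral {0..len G e} (\<lambda>x. f e x * f e x)
      - integral {0..len G e} (\<lambda>x. f' e x * f' e x) \<le> len G e * ((1 - c\<^sup>2) / s) - 2 * W e"
    if e: "e \<in> ?E" for e
  proof -
    let ?I = "{0..len G e}"
    have hi: "((\<lambda>x. 2 * f e x - s * (f e x * f e x) - f' e x * f' e x) has_integral
       2 * integral ?I (f e) - s * integral ?I (\<lambda>x. f e x * f e x) - integral ?I (\<lambda>x. f' e x * f' e x)) ?I"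
      by (intro has_integral_diff has_integral_mult_right integrable_integral integrable_continuous_real
          continuous_intros cf cf' e)
    have hj: "((\<lambda>x. (1 - c\<^sup>2) / s - 2 * \<bar>q (f e x) * f' e x\<bar>) has_integral
        len G e * ((1 - c\<^sup>2) / s) - 2 * W e) ?I"
      unfolding W_def using has_integral_const_real[of "(1 - c\<^sup>2) / s" 0 "len G e"] l[OF e]
      by (intro has_integral_diff has_integral_mult_right integrable_integral integrable_continuous_real
          continuous_intros cf cf' cqf e) simp
    have "2 * f e x - s * (f e x * f e x) - f' e x * f' e x \<le> (1 - c\<^sup>2) / s - 2 * \<bar>q (f e x) * f' e x\<bar>"
      if x: "x \<in> ?I" for x
    proof -
      have "2 * f e x - s * (f e x)\<^sup>2 + (q (f e x))\<^sup>2 = (1 - c\<^sup>2) / s"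
        unfolding q_def using slope_power2[OF s c2] range[OF e x] by simp
      moreover have "2 * \<bar>q (f e x)\<bar> * \<bar>f' e x\<bar> \<le> (q (f e x))\<^sup>2 + (f' e x)\<^sup>2"
        using sum_squares_bound[of "\<bar>q (f e x)\<bar>" "\<bar>f' e x\<bar>"] by simp
      ultimately show ?thesis by (simp add: abs_mult power2_eq_square)
    qed
    with hi hj show ?thesis by (rule has_integral_le)
  qed
  have "2 * graph_integral G f - s * L2_inner G f f - L2_inner G f' f'
      = (\<Sum>e\<in>?E. 2 * integral {0..len G e} (f e) - s * integral {0..len G e} (\<lambda>x. f e x * f e x)
      - integral {0..len G e} (\<lambda>x. f' e x * f' e x))"
    unfolding L2_inner_def
    by (subst (1 2 3) graph_integral_continuous)
       (auto intro!: continuous_intros cf cf' simp: sum_subtractf sum_distrib_left)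
  also have "\<dots> \<le> (\<Sum>e\<in>?E. len G e * ((1 - c\<^sup>2) / s) - 2 * W e)"
    by (intro sum_mono edge)
  also have "\<dots> = total_length G * (1 - c\<^sup>2) / s - 2 * (\<Sum>e\<in>?E. W e)"
    by (simp add: total_length_def sum_subtractf sum_distrib_left sum_distrib_right sum_divide_distrib)
  also have "\<dots> \<le> total_length G * (1 - c\<^sup>2) / s - 2 * integral {0..(1 - c) / s} q"
    using W by simp
  also have "\<dots> \<le> (total_length G - tanh (sqrt s * total_length G) / sqrt s) / s"
    unfolding q_def
  proof (rule slope_bound[OF s _ c])
    show "0 \<le> total_length G"
      unfolding total_length_def by (rule sum_nonneg) (rule less_imp_le[OF l])
  qed
  finally show ?thesis .
qed

section \<open>Positivity of the spectrum and the resolvent series on the graph\<close>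

lemma spectral_basis_arcs:
  assumes "spectral_basis G lam \<phi>"
  shows "arcs (underlying G) \<noteq> {}"
proof
  assume "arcs (underlying G) = {}"
  then have "L2_inner G (\<phi> 0) (\<phi> 0) = 0" by (simp add: L2_inner_def graph_integral_def)
  then show False using assms by (simp add: spectral_basis_def orthonormal_basis_def)
qed

text \<open>By Green's formula an eigenvalue is the Dirichlet energy of its normalised
  eigenfunction. If this vanished, the function would be constant on each edge, and
  \<open>graph_oscillation_le\<close> with zero weights would carry the value 0 from a Dirichlet
  vertex to the whole graph.\<close>

lemma eigenvalue_pos:
  fixes G :: "('v, 'e) metric_graph"
  assumes G: "compact_metric_graph G" "connected_metric_graph G" and D: "dirichlet_verts G \<noteq> {}"
    and B: "spectral_basis G lam \<phi>"
  shows "0 < lam n"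
proof -
  let ?E = "arcs (underlying G)" and ?s = "tail (underlying G)" and ?t = "head (underlying G)"
  interpret fin_digraph "underlying G" using G by (simp add: compact_metric_graph_def)
  have l: "0 < len G e" if "e \<in> ?E" for e
    using G that by (auto simp: compact_metric_graph_def)
  have on: "L2_inner G (\<phi> n) (\<phi> n) = 1"
    using B by (simp add: spectral_basis_def orthonormal_basis_def)
  have "neg_laplacian G (\<phi> n) (\<lambda>e x. lam n * \<phi> n e x)"
    using B by (simp add: spectral_basis_def)
  then obtain d where d: "edgewise_C1 G (\<phi> n) d" "edgewise_C1 G d (\<lambda>e x. - (lam n * \<phi> n e x))"
      "vertex_conditions G (\<phi> n)" "kirchhoff_condition G d"
    by (rule eigenfunction_classical[OF G(1)])
  have lam: "lam n = L2_inner G d d"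
    using Green[OF G(1) d(1,2,4) d(1) d(3)] on by (simp add: L2_inner_cmult_left)
  have "L2_inner G d d \<noteq> 0"
  proof
    assume "L2_inner G d d = 0"
    then have "(\<Sum>e\<in>?E. integral {0..len G e} (\<lambda>x. d e x * d e x)) = 0"
      unfolding L2_inner_def
      by (subst (asm) graph_integral_continuous) (auto intro!: continuous_intros edgewise_C1_continuous_deriv[OF d(1)])
    then have "integral {0..len G e} (\<lambda>x. d e x * d e x) = 0" if "e \<in> ?E" for e
      using that by (subst (asm) sum_nonneg_eq_0_iff) (auto intro!: Henstock_Kurzweil_Integration.integral_nonneg
          integrable_continuous_real continuous_intros edgewise_C1_continuous_deriv[OF d(1)])
    note int0 = this
    have d0: "d e x = 0" if "e \<in> ?E" "x \<in> {0..len G e}" for e x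
    proof -
      have "continuous_on {0..len G e} (\<lambda>x. d e x * d e x)"
        by (intro continuous_intros edgewise_C1_continuous_deriv[OF d(1)] that)
      then have "\<forall>x\<in>{0..len G e}. d e x * d e x = 0"
        using int0[OF that(1)] l[OF that(1)] by (subst (asm) integral_eq_0_iff) auto
      then show ?thesis using that(2) by simp
    qed
    obtain cv where cv: "\<And>e. e \<in> ?E \<Longrightarrow> \<phi> n e 0 = cv (?s e) \<and> \<phi> n e (len G e) = cv (?t e)"
        "\<And>v. v \<in> dirichlet_verts G \<Longrightarrow> cv v = 0"
      using d(3) unfolding vertex_conditions_def by auto
    obtain r where rD: "r \<in> dirichlet_verts G" using D by auto
    have r: "r \<in> verts (underlying G)" using rD G by (auto simp: compact_metric_graph_def)
    have const: "\<bar>\<phi> n e x - \<phi> n e y\<bar> \<le> 0" if "e \<in> ?E" "x \<in> {0..len G e}" "y \<in> {0..len G e}" for e x y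
    proof -
      have "\<bar>\<phi> n e x - \<phi> n e y\<bar> \<le> integral {0..len G e} (\<lambda>t. \<bar>d e t\<bar>)"
        using that by (intro C1_oscillation edgewise_C1_deriv[OF d(1)] edgewise_C1_continuous_deriv[OF d(1)]) auto
      also have "\<dots> = integral {0..len G e} (\<lambda>t. 0)"
        by (rule Henstock_Kurzweil_Integration.integral_cong) (use d0 that in auto)
      finally show ?thesis by simp
    qed
    \<comment> \<open>The oscillation bound is one-sided, so it is applied to the eigenfunction and
      to its negative.\<close>
    have "\<sigma> * \<phi> n e x \<le> 0" if "e \<in> ?E" "x \<in> {0..len G e}" "\<bar>\<sigma>\<bar> = 1" for e x \<sigma>
    proof -
      have "\<sigma> * \<phi> n e x - \<sigma> * cv r \<le> (\<Sum>e\<in>?E. 0)"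
      proof (rule graph_oscillation_le[OF G r, where c = "\<lambda>v. \<sigma> * cv v" and h = "\<lambda>e x. \<sigma> * \<phi> n e x"])
        show "\<bar>\<sigma> * \<phi> n e x - \<sigma> * \<phi> n e y\<bar> \<le> 0"
          if "e \<in> ?E" "x \<in> {0..len G e}" "y \<in> {0..len G e}" for e x y
          using const[OF that] by simp
      qed (use cv(1) that in auto)
      then show ?thesis using cv(2)[OF rD] by simp
    qed
    note sgn = this
    have "\<phi> n e x = 0" if "e \<in> ?E" "x \<in> {0..len G e}" for e x
      using sgn[OF that, of 1] sgn[OF that, of "-1"] by simp
    note \<phi>0 = this
    have "integral\<^sup>L (lebesgue_on {0..len G e}) (\<lambda>x. \<phi> n e x * \<phi> n e x) = 0" if "e \<in> ?E" for e
    proof -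
      have "integral\<^sup>L (lebesgue_on {0..len G e}) (\<lambda>x. \<phi> n e x * \<phi> n e x)
          = integral\<^sup>L (lebesgue_on {0..len G e}) (\<lambda>x. 0)"
        by (rule Bochner_Integration.integral_cong[OF refl]) (simp add: \<phi>0[OF that])
      then show ?thesis by simp
    qed
    then have "L2_inner G (\<phi> n) (\<phi> n) = 0"
      unfolding L2_inner_def graph_integral_def by (rule sum.neutral[rule_format])
    then show False using on by simp
  qed
  then show ?thesis using lam L2_inner_self_nonneg[of G d] by simp
qed

lemma resolvent_partial_sum_le:
  fixes G :: "('v, 'e) metric_graph"
  assumes G: "compact_metric_graph G" "connected_metric_graph G" and D: "dirichlet_verts G \<noteq> {}"
    and B: "spectral_basis G lam \<phi>" and s: "0 < s"
  shows "(\<Sum>n<N. (graph_integral G (\<phi> n))\<^sup>2 / (s + lam n))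
    \<le> (total_length G - tanh (sqrt s * total_length G) / sqrt s) / s"
proof -
  have on: "L2_inner G (\<phi> i) (\<phi> j) = (if i = j then 1 else 0)" for i j
    using B by (auto simp: spectral_basis_def orthonormal_basis_def)
  have "\<forall>n. \<exists>d. edgewise_C1 G (\<phi> n) d \<and> edgewise_C1 G d (\<lambda>e x. - (lam n * \<phi> n e x)) \<and>
      vertex_conditions G (\<phi> n) \<and> kirchhoff_condition G d"
  proof
    fix n
    have "neg_laplacian G (\<phi> n) (\<lambda>e x. lam n * \<phi> n e x)"
      using B by (simp add: spectral_basis_def)
    then show "\<exists>d. edgewise_C1 G (\<phi> n) d \<and> edgewise_C1 G d (\<lambda>e x. - (lam n * \<phi> n e x)) \<and>
        vertex_conditions G (\<phi> n) \<and> kirchhoff_condition G d"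
      by (rule eigenfunction_classical[OF G(1)]) blast
  qed
  from choice[OF this] obtain d where d: "edgewise_C1 G (\<phi> n) (d n)"
      "edgewise_C1 G (d n) (\<lambda>e x. - (lam n * \<phi> n e x))"
      "vertex_conditions G (\<phi> n)" "kirchhoff_condition G (d n)" for n
    by blast
  have \<phi>: "\<phi> n \<in> L2 G" "d n \<in> L2 G" for n using edgewise_C1_L2[OF d(1)] by auto
  define a where "a n = graph_integral G (\<phi> n)" for n
  \<comment> \<open>On the span of the eigenfunctions the functional decouples into terms
    \<open>2 * c n * a n - (s + lam n) * (c n)\<^sup>2\<close>. This \<open>c n\<close> maximises
    its term, with maximum \<open>(a n)\<^sup>2 / (s + lam n)\<close>.\<close>
  define c where "c n = a n / (s + lam n)" for n
  have pos: "0 < s + lam n" for n using eigenvalue_pos[OF G D B, of n] s by simp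
  define u where "u = (\<lambda>e x. \<Sum>n<N. c n * \<phi> n e x)"
  define u' where "u' = (\<lambda>e x. \<Sum>n<N. c n * d n e x)"
  have u: "edgewise_C1 G u u'" "vertex_conditions G u"
    unfolding u_def u'_def
    by (auto intro!: edgewise_C1_sum edgewise_C1_cmult d vertex_conditions_sum)
  note uL2 = edgewise_C1_L2[OF u(1)]
  have left: "L2_inner G u h = (\<Sum>n<N. c n * L2_inner G (\<phi> n) h)" if "h \<in> L2 G" for h
    unfolding u_def using that by (subst L2_inner_sum_left) (auto intro: L2_cmult \<phi> simp: L2_inner_cmult_left)
  have left': "L2_inner G u' h = (\<Sum>n<N. c n * L2_inner G (d n) h)" if "h \<in> L2 G" for h
    unfolding u'_def using that by (subst L2_inner_sum_left) (auto intro: L2_cmult \<phi> simp: L2_inner_cmult_left)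
  have coeff: "L2_inner G (\<phi> n) u = c n" if "n < N" for n
    using left[OF \<phi>(1), of n] that by (simp add: L2_inner_commute[of G "\<phi> n"] on if_distrib cong: if_cong)
  have "graph_integral G u = (\<Sum>n<N. c n * a n)"
    using left[OF L2_const[where c = 1]] by (simp add: L2_inner_def a_def)
  moreover have "L2_inner G u u = (\<Sum>n<N. (c n)\<^sup>2)"
    using left[OF uL2(1)] coeff by (simp add: power2_eq_square)
  \<comment> \<open>The derivatives inherit orthogonality from Green's formula: pairing
    \<open>d n\<close> with \<open>u'\<close> is \<open>lam n\<close> times pairing
    \<open>\<phi> n\<close> with \<open>u\<close>.\<close>
  moreover have "L2_inner G u' u' = (\<Sum>n<N. lam n * (c n)\<^sup>2)"
  proof -
    have "L2_inner G (d n) u' = lam n * c n" if "n < N" for n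
      using Green[OF G(1) d(1)[of n] d(2) d(4) u] coeff[OF that] by (simp add: L2_inner_cmult_left)
    then show ?thesis using left'[OF uL2(2)] by (simp add: power2_eq_square mult_ac)
  qed
  ultimately have "2 * graph_integral G u - s * L2_inner G u u - L2_inner G u' u'
      = (\<Sum>n<N. 2 * (c n * a n) - s * (c n)\<^sup>2 - lam n * (c n)\<^sup>2)"
    by (simp add: sum_subtractf sum_distrib_left)
  also have "\<dots> = (\<Sum>n<N. (a n)\<^sup>2 / (s + lam n))"
  proof (rule sum.cong[OF refl])
    fix n
    have "a n = c n * (s + lam n)" using pos[of n] by (simp add: c_def)
    then have "2 * (c n * a n) - s * (c n)\<^sup>2 - lam n * (c n)\<^sup>2 = c n * a n"
      by (simp add: power2_eq_square algebra_simps)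
    then show "2 * (c n * a n) - s * (c n)\<^sup>2 - lam n * (c n)\<^sup>2 = (a n)\<^sup>2 / (s + lam n)"
      by (simp add: c_def power2_eq_square)
  qed
  finally show ?thesis
    using energy_bound[OF G D spectral_basis_arcs[OF B] s u] by (simp add: a_def)
qed

section \<open>Fractional powers\<close>

text \<open>Riesz-Fischer supplies one solution, so the \<open>SOME\<close> does select a solution.
  All solutions have the same coefficients, and Parseval against the constant 1 turns the integral
  into the series.\<close>

lemma frac_torsional_rigidity_sums:
  fixes G :: "('v, 'e) metric_graph"
  assumes G: "compact_metric_graph G" "connected_metric_graph G" and D: "dirichlet_verts G \<noteq> {}"
    and B: "spectral_basis G lam \<phi>" and \<alpha>: "0 < \<alpha>"
  shows "(\<lambda>n. lam n powr - \<alpha> * (graph_integral G (\<phi> n))\<^sup>2) sums frac_torsional_rigidity G lam \<phi> \<alpha>"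
proof -
  interpret fin_digraph "underlying G" using G by (simp add: compact_metric_graph_def)
  have ob: "orthonormal_basis G \<phi>" and inc: "incseq lam" using B by (auto simp: spectral_basis_def)
  have \<phi>: "\<phi> n \<in> L2 G" and on: "L2_inner G (\<phi> m) (\<phi> n) = (if m = n then 1 else 0)" for m n
    using ob by (auto simp: orthonormal_basis_def)
  have pos: "0 < lam n" for n by (rule eigenvalue_pos[OF G D B])
  have one: "(\<lambda>e x. 1) \<in> L2 G" by (rule L2_const)
  define a where "a n = graph_integral G (\<phi> n)" for n
  have a: "L2_inner G (\<lambda>e x. 1) (\<phi> n) = a n" for n by (simp add: a_def L2_inner_def)
  have a2: "summable (\<lambda>n. (a n)\<^sup>2)"
    using sums_summable[OF Parseval[OF ob one one]] by (simp add: a power2_eq_square)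
  have mult: "lam n powr \<alpha> * (lam n powr - \<alpha> * t) = t" for n t
    using pos[of n] by (simp add: powr_minus field_simps)
  \<comment> \<open>\<open>lam\<close> is positive and increasing, so its negative powers are
    bounded by the first one.\<close>
  have "summable (\<lambda>n. (lam n powr - \<alpha> * a n)\<^sup>2)"
  proof (rule summable_comparison_test'[where N = 0])
    show "summable (\<lambda>n. (lam 0 powr - \<alpha>)\<^sup>2 * (a n)\<^sup>2)" using a2 by (rule summable_mult)
    fix n
    have "lam n powr - \<alpha> \<le> lam 0 powr - \<alpha>"
      using pos[of 0] incseqD[OF inc, of 0 n] \<alpha> by (intro powr_mono2') auto
    then have "(lam n powr - \<alpha>)\<^sup>2 \<le> (lam 0 powr - \<alpha>)\<^sup>2" by (intro power_mono) auto
    then show "norm ((lam n powr - \<alpha> * a n)\<^sup>2) \<le> (lam 0 powr - \<alpha>)\<^sup>2 * (a n)\<^sup>2"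
      by (simp add: power_mult_distrib mult_right_mono)
  qed
  from Riesz_Fischer[OF finite_arcs ob this]
  obtain v where v: "v \<in> L2 G" "\<And>n. L2_inner G v (\<phi> n) = lam n powr - \<alpha> * a n" by blast
  have "frac_laplacian G lam \<phi> \<alpha> v (\<lambda>e x. 1)"
    unfolding frac_laplacian_def
  proof (intro conjI v(1) one)
    have "lam n powr (2 * \<alpha>) * (L2_inner G v (\<phi> n))\<^sup>2 = (a n)\<^sup>2" for n
    proof -
      have eq: "lam n powr (2 * \<alpha>) = (lam n powr \<alpha>)\<^sup>2"
        by (simp add: powr_add[symmetric] power2_eq_square)
      show ?thesis by (simp only: v(2) eq power_mult_distrib[symmetric] mult)
    qed
    then show "summable (\<lambda>n. lam n powr (2 * \<alpha>) * (L2_inner G v (\<phi> n))\<^sup>2)" using a2 by simp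
    show "L2_sums G (\<lambda>n e x. lam n powr \<alpha> * L2_inner G v (\<phi> n) * \<phi> n e x) (\<lambda>e x. 1)"
      using ob one by (simp add: v(2) mult orthonormal_basis_def a[symmetric])
  qed
  then have "frac_laplacian G lam \<phi> \<alpha> (frac_torsion_function G lam \<phi> \<alpha>) (\<lambda>e x. 1)"
    unfolding frac_torsion_function_def
    by (rule someI[where P = "\<lambda>u. frac_laplacian G lam \<phi> \<alpha> u (\<lambda>e x. 1)"])
  then obtain u where u: "u = frac_torsion_function G lam \<phi> \<alpha>" "u \<in> L2 G"
      "L2_sums G (\<lambda>n e x. lam n powr \<alpha> * L2_inner G u (\<phi> n) * \<phi> n e x) (\<lambda>e x. 1)"
    by (auto simp: frac_laplacian_def)
  \<comment> \<open>Pairing the expansion of 1 with \<open>\<phi> n\<close> determines the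
    coefficients of the chosen solution.\<close>
  have "lam n powr \<alpha> * L2_inner G u (\<phi> n) = a n" for n
  proof -
    have "(\<lambda>m. L2_inner G (\<lambda>e x. lam m powr \<alpha> * L2_inner G u (\<phi> m) * \<phi> m e x) (\<phi> n)) sums a n"
      unfolding a[symmetric] by (intro L2_sums_inner L2_cmult \<phi> one u(3))
    then have "(\<lambda>m. if m = n then lam n powr \<alpha> * L2_inner G u (\<phi> n) else 0) sums a n"
      by (simp add: L2_inner_cmult_left on if_distrib cong: if_cong)
    then show ?thesis using sums_single[of n "\<lambda>_. lam n powr \<alpha> * L2_inner G u (\<phi> n)"] sums_unique2 by blast
  qed
  from this[symmetric] have "L2_inner G u (\<phi> n) = lam n powr - \<alpha> * a n" for n
    using pos[of n] by (simp add: powr_minus field_simps)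
  moreover have "(\<lambda>n. L2_inner G u (\<phi> n) * L2_inner G (\<lambda>e x. 1) (\<phi> n)) sums L2_inner G u (\<lambda>e x. 1)"
    by (rule Parseval[OF ob u(2) one])
  ultimately have "(\<lambda>n. lam n powr - \<alpha> * a n * a n) sums graph_integral G u"
    by (simp add: a) (simp add: L2_inner_def)
  then show ?thesis
    by (simp add: frac_torsional_rigidity_def u(1) a_def power2_eq_square mult.assoc)
qed

text \<open>For \<open>\<alpha>\<close> in (0,1) this is \<open>pi / sin (pi * \<alpha>)\<close>. It
  occurs as a common factor of two series and cancels once it is known to be finite and nonzero.
  Working in \<open>ennreal\<close> makes sum and integral interchangeable without integrability
  conditions.\<close>

definition stieltjes_const :: "real \<Rightarrow> ennreal" where
  "stieltjes_const \<alpha> = (\<integral>\<^sup>+s. ennreal (s powr - \<alpha> / (s + 1)) * indicator {0<..} s \<partial>lborel)"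

text \<open>Scaling \<open>s\<close> by \<open>l\<close> brings out the factor
  \<open>l * (l powr - \<alpha> / l)\<close>.\<close>

lemma nn_integral_stieltjes:
  assumes l: "0 < (l :: real)"
  shows "(\<integral>\<^sup>+s. ennreal (s powr - \<alpha> / (s + l)) * indicator {0<..} s \<partial>lborel)
    = ennreal (l powr - \<alpha>) * stieltjes_const \<alpha>"
proof -
  have "(\<integral>\<^sup>+s. ennreal (s powr - \<alpha> / (s + l)) * indicator {0<..} s \<partial>lborel)
      = ennreal l * (\<integral>\<^sup>+s. ennreal ((l * s) powr - \<alpha> / (l * s + l)) * indicator {0<..} (l * s) \<partial>lborel)"
    using l by (subst nn_integral_real_affine[where c = l and t = 0]) auto
  also have "(\<integral>\<^sup>+s. ennreal ((l * s) powr - \<alpha> / (l * s + l)) * indicator {0<..} (l * s) \<partial>lborel)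
      = (\<integral>\<^sup>+s. ennreal (l powr - \<alpha> / l) * (ennreal (s powr - \<alpha> / (s + 1)) * indicator {0<..} s) \<partial>lborel)"
  proof (rule nn_integral_cong)
    fix s :: real
    show "ennreal ((l * s) powr - \<alpha> / (l * s + l)) * indicator {0<..} (l * s)
      = ennreal (l powr - \<alpha> / l) * (ennreal (s powr - \<alpha> / (s + 1)) * indicator {0<..} s)"
    proof (cases "0 < s")
      case True
      then have "(l * s) powr - \<alpha> / (l * s + l) = (l powr - \<alpha> / l) * (s powr - \<alpha> / (s + 1))"
        using l by (simp add: powr_mult distrib_left[symmetric, of l s 1, simplified])
      then show ?thesis using True l by (simp add: ennreal_mult[symmetric])
    qed (use l in \<open>auto simp: zero_less_mult_iff\<close>)
  qed
  also have "\<dots> = ennreal (l powr - \<alpha> / l) * stieltjes_const \<alpha>"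
    unfolding stieltjes_const_def by (rule nn_integral_cmult) auto
  finally show ?thesis
    using l by (simp add: mult.assoc[symmetric] ennreal_mult[symmetric])
qed

text \<open>The integrand is at most \<open>s powr - \<alpha>\<close> near 0, integrable as
  \<open>\<alpha> < 1\<close>, and at most \<open>s powr (- \<alpha> - 1)\<close> near infinity,
  integrable as \<open>0 < \<alpha>\<close>.\<close>

lemma stieltjes_const_finite:
  assumes \<alpha>: "0 < \<alpha>" "\<alpha> < 1"
  shows "stieltjes_const \<alpha> < \<infinity>"
proof -
  have 1: "(\<integral>\<^sup>+s. ennreal (s powr - \<alpha>) * indicator {0..1} s \<partial>lborel) < \<infinity>"
    using nn_integral_has_integral_lebesgue'[OF _ has_integral_powr_from_0[of "- \<alpha>" 1]] \<alpha> by simp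
  have 2: "(\<integral>\<^sup>+s. ennreal (s powr (- \<alpha> - 1)) * indicator {1..} s \<partial>lborel) < \<infinity>"
    using nn_integral_has_integral_lebesgue'[OF _ has_integral_powr_to_inf[of "- \<alpha> - 1" 1]] \<alpha> by simp
  have "stieltjes_const \<alpha> \<le> (\<integral>\<^sup>+s. ennreal (s powr - \<alpha>) * indicator {0..1} s
      + ennreal (s powr (- \<alpha> - 1)) * indicator {1..} s \<partial>lborel)"
    unfolding stieltjes_const_def
  proof (rule nn_integral_mono)
    fix s :: real
    have "s powr - \<alpha> / (s + 1) \<le> s powr - \<alpha>" if "0 < s"
      using that by (simp add: field_simps)
    moreover have "s powr - \<alpha> / (s + 1) \<le> s powr (- \<alpha> - 1)" if "1 < s"
      using that by (simp add: powr_diff frac_le)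
    ultimately consider "\<not> 0 < s"
      | "0 < s" "s \<le> 1" "ennreal (s powr - \<alpha> / (s + 1)) \<le> ennreal (s powr - \<alpha>)"
      | "1 < s" "ennreal (s powr - \<alpha> / (s + 1)) \<le> ennreal (s powr (- \<alpha> - 1))"
      by (meson ennreal_leI not_le)
    then show "ennreal (s powr - \<alpha> / (s + 1)) * indicator {0<..} s
      \<le> ennreal (s powr - \<alpha>) * indicator {0..1} s + ennreal (s powr (- \<alpha> - 1)) * indicator {1..} s"
    proof cases
      case 2
      then show ?thesis by (intro add_increasing2) auto
    next
      case 3
      then show ?thesis by (intro add_increasing) auto
    qed simp
  qed
  also have "\<dots> = (\<integral>\<^sup>+s. ennreal (s powr - \<alpha>) * indicator {0..1} s \<partial>lborel)
      + (\<integral>\<^sup>+s. ennreal (s powr (- \<alpha> - 1)) * indicator {1..} s \<partial>lborel)"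
    by (rule nn_integral_add) auto
  also have "\<dots> < \<infinity>" using 1 2 by simp
  finally show ?thesis .
qed

lemma stieltjes_const_nonzero: "stieltjes_const \<alpha> \<noteq> 0"
proof
  assume "stieltjes_const \<alpha> = 0"
  then have "AE s in lborel. ennreal (s powr - \<alpha> / (s + 1)) * indicator {0<..} s = 0"
    unfolding stieltjes_const_def by (subst (asm) nn_integral_0_iff_AE) auto
  then have "AE s in lborel. s \<notin> {0<..<1 :: real}"
    by eventually_elim (auto simp: indicator_def ennreal_eq_0_iff divide_le_0_iff split: if_splits)
  then have "{0<..<1 :: real} \<in> null_sets lborel"
    by (subst (asm) AE_iff_null_sets[symmetric]) auto
  then show False by (simp add: null_sets_def)
qed

text \<open>Up to the factor \<open>stieltjes_const \<alpha>\<close>, both series are integrals of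
  their resolvent series against the positive weight \<open>s powr - \<alpha>\<close>, so a
  comparison for each \<open>s\<close> integrates to one of the sums.\<close>

lemma powr_series_le:
  fixes l m A B :: "nat \<Rightarrow> real"
  assumes \<alpha>: "0 < \<alpha>" "\<alpha> < 1"
    and pos: "\<And>n. 0 < l n" "\<And>n. 0 < m n" "\<And>n. 0 \<le> A n" "\<And>n. 0 \<le> B n"
    and le: "\<And>s N. 0 < s \<Longrightarrow> (\<Sum>n<N. A n / (s + l n)) \<le> R s"
    and sums: "\<And>s. 0 < s \<Longrightarrow> (\<lambda>n. B n / (s + m n)) sums R s"
    and S: "(\<lambda>n. l n powr - \<alpha> * A n) sums S" and T: "(\<lambda>n. m n powr - \<alpha> * B n) sums T"
  shows "S \<le> T"
proof -
  have repr: "ennreal U * stieltjes_const \<alpha> = (\<integral>\<^sup>+s. (\<Sum>n. ennreal (C n / (s + k n))) * (ennreal (s powr - \<alpha>) * indicator {0<..} s) \<partial>lborel)"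
    if k: "\<And>n. 0 < k n" and C: "\<And>n. 0 \<le> C n" and U: "(\<lambda>n. k n powr - \<alpha> * C n) sums U" for k C :: "nat \<Rightarrow> real" and U
  proof -
    have "ennreal U * stieltjes_const \<alpha> = (\<Sum>n. ennreal (k n powr - \<alpha> * C n)) * stieltjes_const \<alpha>"
      using C U by (subst suminf_ennreal_eq[where x = U]) auto
    also have "\<dots> = (\<Sum>n. ennreal (C n) * (ennreal (k n powr - \<alpha>) * stieltjes_const \<alpha>))"
      using C by (simp add: ennreal_suminf_multc[symmetric] ennreal_mult mult_ac)
    also have "\<dots> = (\<Sum>n. \<integral>\<^sup>+s. ennreal (C n) * (ennreal (s powr - \<alpha> / (s + k n)) * indicator {0<..} s) \<partial>lborel)"
      by (subst nn_integral_stieltjes[OF k, symmetric], subst nn_integral_cmult) auto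
    also have "\<dots> = (\<integral>\<^sup>+s. (\<Sum>n. ennreal (C n) * (ennreal (s powr - \<alpha> / (s + k n)) * indicator {0<..} s)) \<partial>lborel)"
      by (rule nn_integral_suminf[symmetric]) auto
    also have "\<dots> = (\<integral>\<^sup>+s. (\<Sum>n. ennreal (C n / (s + k n))) * (ennreal (s powr - \<alpha>) * indicator {0<..} s) \<partial>lborel)"
    proof (rule nn_integral_cong)
      fix s :: real
      have "ennreal (C n) * (ennreal (s powr - \<alpha> / (s + k n)) * indicator {0<..} s)
          = ennreal (C n / (s + k n)) * (ennreal (s powr - \<alpha>) * indicator {0<..} s)" for n
        using k[of n] C[of n] by (auto simp: indicator_def ennreal_mult[symmetric] mult_ac)
      then show "(\<Sum>n. ennreal (C n) * (ennreal (s powr - \<alpha> / (s + k n)) * indicator {0<..} s))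
          = (\<Sum>n. ennreal (C n / (s + k n))) * (ennreal (s powr - \<alpha>) * indicator {0<..} s)"
        by (simp add: ennreal_suminf_multc)
    qed
    finally show ?thesis .
  qed
  have "ennreal S * stieltjes_const \<alpha> \<le> ennreal T * stieltjes_const \<alpha>"
    unfolding repr[OF pos(1,3) S] repr[OF pos(2,4) T]
  proof (rule nn_integral_mono)
    fix s :: real
    show "(\<Sum>n. ennreal (A n / (s + l n))) * (ennreal (s powr - \<alpha>) * indicator {0<..} s)
       \<le> (\<Sum>n. ennreal (B n / (s + m n))) * (ennreal (s powr - \<alpha>) * indicator {0<..} s)"
    proof (cases "0 < s")
      case True
      have nn: "0 \<le> A n / (s + l n)" "0 \<le> B n / (s + m n)" for n
        using pos(1-4)[of n] True by auto
      have "(\<Sum>n. ennreal (A n / (s + l n))) \<le> ennreal (R s)"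
        using le[OF True] nn by (intro suminf_le_const summableI) (auto simp: sum_ennreal ennreal_leI)
      also have "\<dots> = (\<Sum>n. ennreal (B n / (s + m n)))"
        using suminf_ennreal_eq[OF nn(2) sums[OF True]] by simp
      finally show ?thesis by (rule mult_right_mono) simp
    qed simp
  qed
  then have "ennreal S \<le> ennreal T"
    using stieltjes_const_finite[OF \<alpha>] stieltjes_const_nonzero[of \<alpha>]
    by (simp add: mult.commute[of _ "stieltjes_const \<alpha>"] ennreal_mult_le_mult_iff)
  \<comment> \<open>\<open>ennreal\<close> sends negative reals to 0, so the inequality is pulled
    back to the reals with \<open>T\<close> known to be nonnegative.\<close>
  moreover have "0 \<le> T" using T pos by (intro sums_le[OF _ sums_zero T]) auto
  ultimately show ?thesis by (simp add: ennreal_le_iff)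
qed

section \<open>The interval\<close>

lemma interval_graph_simps [simp]:
  "arcs (underlying (interval_graph L)) = {()}" "verts (underlying (interval_graph L)) = {0, 1}"
  "tail (underlying (interval_graph L)) = (\<lambda>_. 0)" "head (underlying (interval_graph L)) = (\<lambda>_. 1)"
  "len (interval_graph L) = (\<lambda>_. L)" "dirichlet_verts (interval_graph L) = {0}"
  by (simp_all add: interval_graph_def)

lemma compact_interval_graph: "0 < L \<Longrightarrow> compact_metric_graph (interval_graph L)"
  by (auto simp: compact_metric_graph_def fin_digraph_def fin_digraph_axioms_def wf_digraph_def)

lemma connected_interval_graph: "connected_metric_graph (interval_graph L)"
proof -
  have "u \<rightarrow>\<^sup>*\<^bsub>with_proj (mk_symmetric (underlying (interval_graph L)))\<^esub> v"
    if "u \<in> {0, 1}" "v \<in> {0, 1}" for u v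
  proof (cases "u = v")
    case True
    then show ?thesis using that by (auto simp: reachable_def mk_symmetric_def)
  next
    case False
    then have "(u, v) \<in> {(0, 1), (1, 0)}" using that by auto
    then show ?thesis using that unfolding reachable_def
      by (intro rtrancl_on_into_rtrancl_on[OF rtrancl_on_refl]) (auto simp: mk_symmetric_def)
  qed
  then show ?thesis
    by (auto simp: connected_metric_graph_def Digraph_Component.connected_def strongly_connected_def mk_symmetric_def)
qed

lemma graph_integral_interval:
  "continuous_on {0..L} (f ()) \<Longrightarrow> graph_integral (interval_graph L) f = integral {0..L} (f ())"
  by (subst graph_integral_continuous) auto

lemma edgewise_C1_interval:
  "edgewise_C1 (interval_graph L) f f' \<longleftrightarrow> continuous_on {0..L} (f' ()) \<and>
    (\<forall>x\<in>{0..L}. (f () has_real_derivative f' () x) (at x within {0..L}))"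
  by (simp add: edgewise_C1_def)

lemma vertex_conditions_interval:
  assumes "f () 0 = 0"
  shows "vertex_conditions (interval_graph L) f"
  unfolding vertex_conditions_def
  using assms by (intro exI[of _ "\<lambda>v. if v = 0 then 0 else f () L"]) auto

lemma kirchhoff_condition_interval: "kirchhoff_condition (interval_graph L) f' \<longleftrightarrow> f' () L = 0"
proof -
  have "{0, 1} - {0} = {1 :: nat}" by auto
  then show ?thesis by (simp add: kirchhoff_condition_def UNIV_unit)
qed

text \<open>An explicit \<open>w\<close> solves \<open>- w'' + s * w = 1\<close> with the boundary
  conditions of the interval. Green's formula in both directions gives its coefficients in any
  spectral basis, and Parseval against 1 expresses the series as the integral of
  \<open>w\<close>.\<close>

lemma interval_resolvent_sums:
  assumes L: "0 < L" and s: "0 < s" and B: "spectral_basis (interval_graph L) mu \<psi>"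
  shows "(\<lambda>n. (graph_integral (interval_graph L) (\<psi> n))\<^sup>2 / (s + mu n))
    sums ((L - tanh (sqrt s * L) / sqrt s) / s)"
proof -
  let ?I = "interval_graph L"
  have G: "compact_metric_graph ?I" by (rule compact_interval_graph[OF L])
  have ob: "orthonormal_basis ?I \<psi>" using B by (simp add: spectral_basis_def)
  define k where "k = sqrt s"
  have k: "0 < k" "k * k = s" using s by (auto simp: k_def)
  have ch: "0 < cosh (k * L)" by simp
  define w where "w = (\<lambda>(e::unit) x. (1 - cosh (k * (L - x)) / cosh (k * L)) / s)"
  define w' where "w' = (\<lambda>(e::unit) x. k * sinh (k * (L - x)) / cosh (k * L) / s)"
  have w: "edgewise_C1 ?I w w'" "edgewise_C1 ?I w' (\<lambda>e x. - (1 - s * w e x))"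
    unfolding edgewise_C1_interval w_def w'_def
    using s ch k(2) by (auto intro!: continuous_intros derivative_eq_intros simp: field_simps)
  have vw: "vertex_conditions ?I w" by (rule vertex_conditions_interval) (simp add: w_def)
  have kw: "kirchhoff_condition ?I w'" by (simp add: kirchhoff_condition_interval w'_def)
  have wL2: "w \<in> L2 ?I" using edgewise_C1_L2[OF w(1)] by simp
  have one: "(\<lambda>e x. 1) \<in> L2 ?I" by (rule L2_const)
  have coeff: "L2_inner ?I w (\<psi> n) = graph_integral ?I (\<psi> n) / (s + mu n)" for n
  proof -
    have "neg_laplacian ?I (\<psi> n) (\<lambda>e x. mu n * \<psi> n e x)"
      using B by (simp add: spectral_basis_def)
    then obtain d where d: "edgewise_C1 ?I (\<psi> n) d" "edgewise_C1 ?I d (\<lambda>e x. - (mu n * \<psi> n e x))"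
        "vertex_conditions ?I (\<psi> n)" "kirchhoff_condition ?I d"
      by (rule eigenfunction_classical[OF G])
    have "L2_inner ?I (\<lambda>e x. 1 - s * w e x) (\<psi> n) = L2_inner ?I w' d"
      by (rule Green[OF G w kw d(1,3)])
    moreover have "L2_inner ?I (\<lambda>e x. mu n * \<psi> n e x) w = L2_inner ?I d w'"
      by (rule Green[OF G d(1,2,4) w(1) vw])
    moreover have "L2_inner ?I (\<lambda>e x. 1 - s * w e x) (\<psi> n)
        = graph_integral ?I (\<psi> n) - s * L2_inner ?I w (\<psi> n)"
      using L2_inner_diff_left[OF one L2_cmult[OF wL2] edgewise_C1_L2(1)[OF d(1)], of s]
      by (simp add: L2_inner_cmult_left) (simp add: L2_inner_def)
    ultimately have "graph_integral ?I (\<psi> n) = (s + mu n) * L2_inner ?I w (\<psi> n)"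
      by (simp add: L2_inner_cmult_left L2_inner_commute[of ?I d] L2_inner_commute[of ?I "\<psi> n"] algebra_simps)
    moreover have "0 < s + mu n"
      using s eigenvalue_pos[OF G connected_interval_graph _ B, of n] by simp
    ultimately show ?thesis by simp
  qed
  have "(\<lambda>n. L2_inner ?I w (\<psi> n) * L2_inner ?I (\<lambda>e x. 1) (\<psi> n)) sums L2_inner ?I w (\<lambda>e x. 1)"
    by (rule Parseval[OF ob wL2 one])
  then have "(\<lambda>n. (graph_integral ?I (\<psi> n))\<^sup>2 / (s + mu n)) sums graph_integral ?I w"
    by (simp add: coeff) (simp add: L2_inner_def power2_eq_square)
  also have "graph_integral ?I w = integral {0..L} (w ())"
    by (intro graph_integral_interval edgewise_C1_continuous[OF w(1), simplified])
  also have "\<dots> = (L - tanh (sqrt s * L) / sqrt s) / s"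
  proof (rule integral_unique)
    define W where "W x = (x + sinh (k * (L - x)) / (k * cosh (k * L))) / s" for x
    have "(w () has_integral W L - W 0) {0..L}"
      unfolding w_def W_def[abs_def]
      using s k ch L by (intro has_integral_derivative) (auto intro!: derivative_eq_intros simp: field_simps)
    moreover have "W L - W 0 = (L - tanh (sqrt s * L) / sqrt s) / s"
      using s k ch by (simp add: W_def k_def[symmetric] tanh_def field_simps)
    ultimately show "(w () has_integral (L - tanh (sqrt s * L) / sqrt s) / s) {0..L}" by simp
  qed
  finally show ?thesis .
qed

section \<open>Spectrum of the interval\<close>

lemma constant_on_interval:
  fixes F :: "real \<Rightarrow> real"
  assumes "\<And>x. x \<in> {a..b} \<Longrightarrow> (F has_real_derivative 0) (at x within {a..b})"
    and "x \<in> {a..b}" "y \<in> {a..b}"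
  shows "F x = F y"
  using C1_oscillation[of a b F "\<lambda>_. 0" x y] assms by auto

lemma oscillator_solution:
  fixes y y' :: "real \<Rightarrow> real"
  assumes \<kappa>: "0 < \<kappa>"
    and y: "\<And>x. x \<in> {0..L} \<Longrightarrow> (y has_real_derivative y' x) (at x within {0..L})"
    and y': "\<And>x. x \<in> {0..L} \<Longrightarrow> (y' has_real_derivative - (\<kappa>\<^sup>2 * y x)) (at x within {0..L})"
    and y0: "y 0 = 0" and x: "x \<in> {0..L}"
  shows "y x = y' 0 / \<kappa> * sin (\<kappa> * x)" "y' x = y' 0 * cos (\<kappa> * x)"
proof -
  \<comment> \<open>The vector \<open>(\<kappa> * y, y')\<close> rotates with angular speed
    \<open>\<kappa>\<close>; \<open>p\<close> and \<open>r\<close> are its coordinates rotated back,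
    hence constant. Rotating forward again recovers \<open>y\<close> and \<open>y'\<close>.\<close>
  define p where "p x = \<kappa> * y x * cos (\<kappa> * x) - y' x * sin (\<kappa> * x)" for x
  define r where "r x = \<kappa> * y x * sin (\<kappa> * x) + y' x * cos (\<kappa> * x)" for x
  have 0: "0 \<in> {0..L}" using x by auto
  have "p x = p 0"
  proof (rule constant_on_interval[OF _ x 0])
    fix t assume t: "t \<in> {0..L}"
    show "(p has_real_derivative 0) (at t within {0..L})"
      unfolding p_def[abs_def]
      by (auto intro!: derivative_eq_intros y[OF t] y'[OF t] simp: power2_eq_square algebra_simps)
  qed
  then have p: "p x = 0" by (simp add: p_def y0)
  have "r x = r 0"
  proof (rule constant_on_interval[OF _ x 0])
    fix t assume t: "t \<in> {0..L}"
    show "(r has_real_derivative 0) (at t within {0..L})"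
      unfolding r_def[abs_def]
      by (auto intro!: derivative_eq_intros y[OF t] y'[OF t] simp: power2_eq_square algebra_simps)
  qed
  then have r: "r x = y' 0" by (simp add: r_def y0)
  let ?c = "cos (\<kappa> * x)" and ?s = "sin (\<kappa> * x)"
  have sc: "?c * ?c + ?s * ?s = 1" using sin_cos_squared_add2[of "\<kappa> * x"] by (simp add: power2_eq_square)
  have "p x * ?c + r x * ?s = \<kappa> * y x * (?c * ?c + ?s * ?s)"
    unfolding p_def r_def by (simp add: algebra_simps del: sin_cos_squared_add3)
  then have "\<kappa> * y x = y' 0 * ?s" by (simp add: p r sc)
  then show "y x = y' 0 / \<kappa> * ?s" using \<kappa> by (simp add: field_simps)
  have "r x * ?c - p x * ?s = y' x * (?c * ?c + ?s * ?s)"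
    unfolding p_def r_def by (simp add: algebra_simps del: sin_cos_squared_add3)
  then show "y' x = y' 0 * ?c" by (simp add: p r sc)
qed

text \<open>The positive solutions of \<open>cos (\<kappa> * L) = 0\<close>, which is the Neumann
  condition at \<open>L\<close> for \<open>sin (\<kappa> * x)\<close>.\<close>

definition interval_freq :: "real \<Rightarrow> nat \<Rightarrow> real" where
  "interval_freq L k = (2 * real k + 1) * pi / (2 * L)"

lemma interval_freq_pos: "0 < L \<Longrightarrow> 0 < interval_freq L k"
  by (simp add: interval_freq_def)

lemma interval_freq_inj: "0 < L \<Longrightarrow> interval_freq L j = interval_freq L k \<Longrightarrow> j = k"
  by (simp add: interval_freq_def)

lemma interval_freq_mult: "0 < L \<Longrightarrow> interval_freq L k * L = (2 * real k + 1) * (pi / 2)"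
  by (simp add: interval_freq_def)

lemma cos_interval_freq: "0 < L \<Longrightarrow> cos (interval_freq L k * L) = 0"
  unfolding interval_freq_mult cos_zero_iff by (intro disjI1 exI[of _ "2 * k + 1"]) simp

lemma cos_zero_imp_interval_freq:
  assumes "0 < L" "0 < \<kappa>" "cos (\<kappa> * L) = 0"
  obtains k where "\<kappa> = interval_freq L k"
proof -
  obtain n :: nat where "odd n" "\<kappa> * L = real n * (pi / 2)"
    using cos_zero_lemma[of "\<kappa> * L"] assms by auto
  then obtain k where "n = 2 * k + 1" by (auto elim: oddE)
  then have "\<kappa> = interval_freq L k"
    using \<open>\<kappa> * L = real n * (pi / 2)\<close> assms by (simp add: interval_freq_def field_simps)
  then show thesis by (rule that)
qed

text \<open>The primitive comes from the double-angle formula; its oscillating part vanishes at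
  \<open>L\<close> because the cosine does.\<close>

lemma integral_sin_sq_interval:
  assumes "0 < L"
  shows "integral {0..L} (\<lambda>x. sin (interval_freq L k * x) * sin (interval_freq L k * x)) = L / 2"
proof (rule integral_unique)
  define \<kappa> where "\<kappa> = interval_freq L k"
  have \<kappa>: "0 < \<kappa>" "cos (\<kappa> * L) = 0"
    using interval_freq_pos cos_interval_freq assms by (auto simp: \<kappa>_def)
  define F where "F x = x / 2 - sin (\<kappa> * x) * cos (\<kappa> * x) / (2 * \<kappa>)" for x
  have "((\<lambda>x. sin (\<kappa> * x) * sin (\<kappa> * x)) has_integral F L - F 0) {0..L}"
  proof (rule has_integral_derivative)
    fix x
    have "sin (\<kappa> * x) * sin (\<kappa> * x) = 1 / 2 - (cos (\<kappa> * x) * cos (\<kappa> * x) - sin (\<kappa> * x) * sin (\<kappa> * x)) / 2"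
    proof -
      have "a = 1 / 2 - (b - a) / 2" if "a + b = 1" for a b :: real
        using that by (simp add: field_simps)
      from this[OF sin_cos_squared_add[of "\<kappa> * x"]] show ?thesis by (simp only: power2_eq_square)
    qed
    moreover have "(F has_real_derivative 1 / 2 - (cos (\<kappa> * x) * cos (\<kappa> * x) - sin (\<kappa> * x) * sin (\<kappa> * x)) / 2) (at x within {0..L})"
      unfolding F_def[abs_def] using \<kappa>(1) by (auto intro!: derivative_eq_intros simp: field_simps)
    ultimately show "(F has_real_derivative sin (\<kappa> * x) * sin (\<kappa> * x)) (at x within {0..L})" by simp
  qed (use assms in simp)
  then show "((\<lambda>x. sin (interval_freq L k * x) * sin (interval_freq L k * x)) has_integral L / 2) {0..L}"
    using \<kappa>(2) by (simp add: F_def \<kappa>_def[symmetric])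
qed

text \<open>Solving the oscillator equation makes every basis function a multiple of one of the
  sines. Orthogonality shows that no sine occurs twice, completeness that none is missing. The sign
  of a basis function stays free, hence the square of its integral.\<close>

lemma interval_spectrum:
  assumes L: "0 < L" and B: "spectral_basis (interval_graph L) mu \<psi>"
  obtains \<pi> where "bij \<pi>" "\<And>n. mu n = (interval_freq L (\<pi> n))\<^sup>2"
    "\<And>n. (graph_integral (interval_graph L) (\<psi> n))\<^sup>2 = 2 / L / mu n"
proof -
  let ?I = "interval_graph L"
  have G: "compact_metric_graph ?I" by (rule compact_interval_graph[OF L])
  have ob: "orthonormal_basis ?I \<psi>" using B by (simp add: spectral_basis_def)
  have on: "L2_inner ?I (\<psi> i) (\<psi> j) = (if i = j then 1 else 0)" for i j
    using ob by (auto simp: orthonormal_basis_def)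
  have pos: "0 < mu n" for n
    using eigenvalue_pos[OF G connected_interval_graph _ B, of n] by simp
  have ex: "\<exists>d. edgewise_C1 ?I (\<psi> n) d \<and> edgewise_C1 ?I d (\<lambda>e x. - (mu n * \<psi> n e x)) \<and>
      vertex_conditions ?I (\<psi> n) \<and> kirchhoff_condition ?I d" for n
  proof -
    have "neg_laplacian ?I (\<psi> n) (\<lambda>e x. mu n * \<psi> n e x)"
      using B by (simp add: spectral_basis_def)
    then show ?thesis by (rule eigenfunction_classical[OF G]) blast
  qed
  define sn where "sn k = (\<lambda>(e::unit) x. sin (interval_freq L k * x))" for k
  have snL2: "sn k \<in> L2 ?I" for k
    by (auto simp: L2_def sn_def intro!: L2_interval_continuous continuous_intros)
  have sn_sq: "L2_inner ?I (sn k) (sn k) = L / 2" for k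
    unfolding L2_inner_def sn_def using integral_sin_sq_interval[OF L, of k]
    by (subst graph_integral_interval) (auto intro!: continuous_intros)
  have key: "\<exists>k A. mu n = (interval_freq L k)\<^sup>2 \<and> (\<forall>x\<in>{0..L}. \<psi> n () x = A * sn k () x)" for n
  proof -
    obtain d where d: "edgewise_C1 ?I (\<psi> n) d" "edgewise_C1 ?I d (\<lambda>e x. - (mu n * \<psi> n e x))"
        "vertex_conditions ?I (\<psi> n)" "kirchhoff_condition ?I d" using ex by blast
    define \<kappa> where "\<kappa> = sqrt (mu n)"
    have \<kappa>: "0 < \<kappa>" "\<kappa>\<^sup>2 = mu n" using pos[of n] by (auto simp: \<kappa>_def)
    have y0: "\<psi> n () 0 = 0" using d(3) by (auto simp: vertex_conditions_def)
    have sol: "\<psi> n () x = d () 0 / \<kappa> * sin (\<kappa> * x)" "d () x = d () 0 * cos (\<kappa> * x)" if "x \<in> {0..L}" for x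
      using oscillator_solution[OF \<kappa>(1), of L "\<psi> n ()" "d ()" x] d(1,2) y0 that \<kappa>(2)
      by (auto simp: edgewise_C1_interval)
    have "d () 0 \<noteq> 0"
    proof
      assume "d () 0 = 0"
      then have "\<psi> n () x * \<psi> n () x = 0" if "x \<in> {0..L}" for x using sol(1)[OF that] by simp
      then have "integral {0..L} (\<lambda>x. \<psi> n () x * \<psi> n () x) = integral {0..L} (\<lambda>x. 0)"
        by (intro Henstock_Kurzweil_Integration.integral_cong)
      moreover have "L2_inner ?I (\<psi> n) (\<psi> n) = integral {0..L} (\<lambda>x. \<psi> n () x * \<psi> n () x)"
        unfolding L2_inner_def
        by (intro graph_integral_interval continuous_intros edgewise_C1_continuous[OF d(1), simplified])
      ultimately show False using on[of n n] by simp
    qed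
    moreover have "d () L = 0" using d(4) by (simp add: kirchhoff_condition_interval)
    ultimately have "cos (\<kappa> * L) = 0" using sol(2)[of L] L by simp
    then obtain k where k: "\<kappa> = interval_freq L k"
      using cos_zero_imp_interval_freq[OF L \<kappa>(1)] by blast
    then have "mu n = (interval_freq L k)\<^sup>2 \<and> (\<forall>x\<in>{0..L}. \<psi> n () x = (d () 0 / \<kappa>) * sn k () x)"
      using \<kappa>(2) sol(1) by (simp add: sn_def)
    then show ?thesis by blast
  qed
  then have "\<forall>n. \<exists>k A. mu n = (interval_freq L k)\<^sup>2 \<and> (\<forall>x\<in>{0..L}. \<psi> n () x = A * sn k () x)"
    by blast
  from choice[OF this] obtain \<pi> where "\<forall>n. \<exists>A. mu n = (interval_freq L (\<pi> n))\<^sup>2 \<and>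
      (\<forall>x\<in>{0..L}. \<psi> n () x = A * sn (\<pi> n) () x)" by blast
  from choice[OF this] obtain A where "\<forall>n. mu n = (interval_freq L (\<pi> n))\<^sup>2 \<and>
      (\<forall>x\<in>{0..L}. \<psi> n () x = A n * sn (\<pi> n) () x)" by blast
  then have mu: "mu n = (interval_freq L (\<pi> n))\<^sup>2"
    and \<psi>: "x \<in> {0..L} \<Longrightarrow> \<psi> n () x = A n * sn (\<pi> n) () x" for n x by auto
  have inner: "L2_inner ?I (\<psi> n) h = A n * L2_inner ?I (sn (\<pi> n)) h" for n h
  proof -
    have "L2_inner ?I (\<psi> n) h = L2_inner ?I (\<lambda>e x. A n * sn (\<pi> n) e x) h"
      unfolding L2_inner_def graph_integral_def
      by (auto intro!: Bochner_Integration.integral_cong simp: \<psi>)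
    then show ?thesis by (simp add: L2_inner_cmult_left)
  qed
  have inner2: "L2_inner ?I (\<psi> m) (\<psi> n) = A m * (A n * L2_inner ?I (sn (\<pi> m)) (sn (\<pi> n)))" for m n
    using inner[of m "\<psi> n"] inner[of n "sn (\<pi> m)"] by (simp add: L2_inner_commute)
  have A: "(A n)\<^sup>2 = 2 / L" for n
    using inner2[of n n] sn_sq[of "\<pi> n"] on[of n n] L by (simp add: power2_eq_square field_simps)
  \<comment> \<open>Two basis functions with the same frequency are nonzero multiples of the same
    sine and so cannot be orthogonal.\<close>
  have "inj \<pi>"
  proof (rule injI)
    fix m n assume eq: "\<pi> m = \<pi> n"
    have "A m \<noteq> 0" "A n \<noteq> 0" using A[of m] A[of n] L by auto
    then have "A m * (A n * (L / 2)) \<noteq> 0" using L by simp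
    moreover have "L2_inner ?I (\<psi> m) (\<psi> n) = A m * (A n * (L / 2))"
      by (simp only: inner2 eq sn_sq)
    ultimately have "L2_inner ?I (\<psi> m) (\<psi> n) \<noteq> 0" by (simp only: not_False_eq_True)
    then show "m = n" using on[of m n] by (auto split: if_splits)
  qed
  moreover have "surj \<pi>"
  proof (rule ccontr)
    assume "\<not> surj \<pi>"
    \<comment> \<open>The missing sine is an eigenfunction whose eigenvalue differs from every
      \<open>mu n\<close>; by Green's formula it is orthogonal to the whole basis, and Parseval
      makes its norm 0.\<close>
    then obtain k where k: "\<And>n. \<pi> n \<noteq> k" by (metis surjI surj_def)
    define \<kappa> where "\<kappa> = interval_freq L k"
    define cs where "cs = (\<lambda>(e::unit) x. \<kappa> * cos (\<kappa> * x))"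
    have C1: "edgewise_C1 ?I (sn k) cs" "edgewise_C1 ?I cs (\<lambda>e x. - (\<kappa>\<^sup>2 * sn k e x))"
      unfolding edgewise_C1_interval sn_def cs_def \<kappa>_def
      by (auto intro!: continuous_intros derivative_eq_intros simp: power2_eq_square)
    have vk: "vertex_conditions ?I (sn k)" by (rule vertex_conditions_interval) (simp add: sn_def)
    have kk: "kirchhoff_condition ?I cs"
      using cos_interval_freq[OF L, of k] by (simp add: kirchhoff_condition_interval cs_def \<kappa>_def)
    have orth: "L2_inner ?I (sn k) (\<psi> n) = 0" for n
    proof -
      obtain d where d: "edgewise_C1 ?I (\<psi> n) d" "edgewise_C1 ?I d (\<lambda>e x. - (mu n * \<psi> n e x))"
          "vertex_conditions ?I (\<psi> n)" "kirchhoff_condition ?I d" using ex by blast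
      have "L2_inner ?I (\<lambda>e x. \<kappa>\<^sup>2 * sn k e x) (\<psi> n) = L2_inner ?I cs d"
        by (rule Green[OF G C1 kk d(1,3)])
      moreover have "L2_inner ?I (\<lambda>e x. mu n * \<psi> n e x) (sn k) = L2_inner ?I d cs"
        by (rule Green[OF G d(1,2,4) C1(1) vk])
      ultimately have "\<kappa>\<^sup>2 * L2_inner ?I (sn k) (\<psi> n) = mu n * L2_inner ?I (sn k) (\<psi> n)"
        by (simp add: L2_inner_cmult_left L2_inner_commute[of ?I d] L2_inner_commute[of ?I "\<psi> n"])
      moreover have "\<kappa>\<^sup>2 \<noteq> mu n"
      proof
        assume "\<kappa>\<^sup>2 = mu n"
        then have "\<kappa> = interval_freq L (\<pi> n)"
          unfolding mu \<kappa>_def using interval_freq_pos[OF L] by (simp add: power2_eq_iff_nonneg less_imp_le)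
        then show False using interval_freq_inj[OF L] k[of n] by (auto simp: \<kappa>_def)
      qed
      ultimately show ?thesis by simp
    qed
    have "(\<lambda>n. L2_inner ?I (sn k) (\<psi> n) * L2_inner ?I (sn k) (\<psi> n)) sums L2_inner ?I (sn k) (sn k)"
      by (rule Parseval[OF ob snL2 snL2])
    then have "L2_inner ?I (sn k) (sn k) = 0" by (simp add: orth sums_unique2[OF _ sums_zero])
    then show False using sn_sq[of k] L by simp
  qed
  ultimately have "bij \<pi>" by (simp add: bij_def)
  moreover have "(graph_integral ?I (\<psi> n))\<^sup>2 = 2 / L / mu n" for n
  proof -
    define \<kappa> where "\<kappa> = interval_freq L (\<pi> n)"
    have \<kappa>: "0 < \<kappa>" "cos (\<kappa> * L) = 0" using interval_freq_pos[OF L] cos_interval_freq[OF L] by (auto simp: \<kappa>_def)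
    have "graph_integral ?I (\<psi> n) = A n * L2_inner ?I (sn (\<pi> n)) (\<lambda>e x. 1)"
      using inner[of n "\<lambda>e x. 1"] by (simp add: L2_inner_def)
    also have "L2_inner ?I (sn (\<pi> n)) (\<lambda>e x. 1) = integral {0..L} (\<lambda>x. sin (\<kappa> * x))"
      unfolding L2_inner_def by (subst graph_integral_interval) (auto intro!: continuous_intros simp: sn_def \<kappa>_def)
    also have "\<dots> = 1 / \<kappa>"
    proof (rule integral_unique)
      have "((\<lambda>x. sin (\<kappa> * x)) has_integral - cos (\<kappa> * L) / \<kappa> - - cos (\<kappa> * 0) / \<kappa>) {0..L}"
        using \<kappa>(1) L by (intro has_integral_derivative) (auto intro!: derivative_eq_intros)
      then show "((\<lambda>x. sin (\<kappa> * x)) has_integral 1 / \<kappa>) {0..L}" using \<kappa>(2) by simp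
    qed
    finally show ?thesis using A[of n] mu[of n] by (simp add: power_divide \<kappa>_def)
  qed
  ultimately show thesis using mu that by blast
qed

text \<open>The terms of even base in the zeta series add up to \<open>2 powr - p\<close> times the
  series itself; removing them leaves the odd ones.\<close>

lemma odd_zeta_sums:
  assumes p: "1 < p"
  shows "(\<lambda>k. (2 * real k + 1) powr - p) sums ((1 - 2 powr - p) * zeta_series p)"
proof -
  define f where "f n = real (Suc n) powr - p" for n
  have "summable (\<lambda>n. real n powr - p)" using p by (simp add: summable_real_powr_iff)
  then have "summable f" unfolding f_def[abs_def] by (subst summable_Suc_iff)
  then have f: "f sums zeta_series p" unfolding zeta_series_def f_def[abs_def] by (rule summable_sums)
  \<comment> \<open>The index is shifted by one: \<open>f (2 * k)\<close> has the odd base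
    \<open>2 * k + 1\<close>, and \<open>f (2 * k + 1)\<close> the even base
    \<open>2 * k + 2\<close>.\<close>
  from sums_group[OF f, of 2] have "(\<lambda>k. f (2 * k) + f (2 * k + 1)) sums zeta_series p"
    by (simp add: numeral_2_eq_2 mult.commute)
  moreover have "(\<lambda>k. 2 powr - p * f k) sums (2 powr - p * zeta_series p)"
    by (rule sums_mult[OF f])
  ultimately have "(\<lambda>k. f (2 * k) + f (2 * k + 1) - 2 powr - p * f k) sums (zeta_series p - 2 powr - p * zeta_series p)"
    by (rule sums_diff)
  moreover have "f (2 * k + 1) = 2 powr - p * f k" for k
  proof -
    have "real (Suc (2 * k + 1)) = 2 * real (Suc k)" by simp
    then show ?thesis unfolding f_def by (simp only: powr_mult)
  qed
  ultimately show ?thesis by (simp add: f_def algebra_simps)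
qed

text \<open>Nonnegative series converge unconditionally.\<close>

lemma sums_bij:
  fixes f :: "nat \<Rightarrow> real"
  assumes "bij \<pi>" "\<And>n. 0 \<le> f n" "f sums S"
  shows "(\<lambda>n. f (\<pi> n)) sums S"
proof -
  have "(f has_sum S) UNIV" using assms by (intro sums_nonneg_imp_has_sum)
  then have "((\<lambda>n. f (\<pi> n)) has_sum S) UNIV"
    using has_sum_reindex_bij_betw[of \<pi> UNIV UNIV f S] assms(1) by simp
  then show ?thesis by (rule has_sum_imp_sums)
qed

lemma interval_frac_torsional_rigidity:
  assumes L: "0 < L" and \<alpha>: "0 < \<alpha>" and B: "spectral_basis (interval_graph L) mu \<psi>"
  shows "frac_torsional_rigidity (interval_graph L) mu \<psi> \<alpha>
    = 8 * 2 powr (2 * \<alpha>) * L powr (2 * \<alpha> + 1) / pi powr (2 + 2 * \<alpha>)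
             * (1 - 2 powr - (2 + 2 * \<alpha>)) * zeta_series (2 + 2 * \<alpha>)"
proof -
  let ?I = "interval_graph L" and ?p = "2 + 2 * \<alpha>"
  obtain \<pi> where \<pi>: "bij \<pi>" "\<And>n. mu n = (interval_freq L (\<pi> n))\<^sup>2"
    "\<And>n. (graph_integral ?I (\<psi> n))\<^sup>2 = 2 / L / mu n"
    using interval_spectrum[OF L B] by blast
  \<comment> \<open>The contribution of the \<open>k\<close>-th frequency \<open>\<kappa>\<close>:
    the squared integral \<open>2 / L / \<kappa>\<^sup>2\<close> times
    \<open>\<kappa> powr (- 2 * \<alpha>)\<close>, the power of the eigenvalue.\<close>
  define g where "g k = 2 / L * interval_freq L k powr - ?p" for k
  have "(\<lambda>k. 2 / L * (pi / (2 * L)) powr - ?p * (2 * real k + 1) powr - ?p)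
      sums (2 / L * (pi / (2 * L)) powr - ?p * ((1 - 2 powr - ?p) * zeta_series ?p))"
    using \<alpha> by (intro sums_mult odd_zeta_sums) simp
  moreover have "2 / L * (pi / (2 * L)) powr - ?p * (2 * real k + 1) powr - ?p = g k" for k
  proof -
    have "interval_freq L k = pi / (2 * L) * (2 * real k + 1)" by (simp add: interval_freq_def)
    then show ?thesis unfolding g_def by (simp only: powr_mult mult.assoc)
  qed
  ultimately have g: "g sums (2 / L * (pi / (2 * L)) powr - ?p * ((1 - 2 powr - ?p) * zeta_series ?p))"
    by simp
  have "(\<lambda>n. g (\<pi> n)) sums (2 / L * (pi / (2 * L)) powr - ?p * ((1 - 2 powr - ?p) * zeta_series ?p))"
    by (rule sums_bij[OF \<pi>(1) _ g]) (use L in \<open>simp add: g_def\<close>)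
  moreover have "g (\<pi> n) = mu n powr - \<alpha> * (graph_integral ?I (\<psi> n))\<^sup>2" for n
  proof -
    define \<kappa> where "\<kappa> = interval_freq L (\<pi> n)"
    have \<kappa>: "0 < \<kappa>" using interval_freq_pos[OF L] by (simp add: \<kappa>_def)
    have "\<kappa>\<^sup>2 = \<kappa> powr 2" using \<kappa> by (simp add: powr_numeral)
    then have "(\<kappa>\<^sup>2) powr - \<alpha> / \<kappa>\<^sup>2 = \<kappa> powr (- 2 * \<alpha>) / \<kappa> powr 2"
      by (simp add: powr_powr)
    also have "\<dots> = \<kappa> powr (- 2 * \<alpha> - 2)" by (simp only: powr_diff)
    also have "- 2 * \<alpha> - 2 = - ?p" by simp
    finally have e: "(\<kappa>\<^sup>2) powr - \<alpha> / \<kappa>\<^sup>2 = \<kappa> powr - ?p" .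
    show ?thesis
      unfolding \<pi>(3) g_def \<pi>(2) \<kappa>_def[symmetric] e[symmetric] by simp
  qed
  moreover have "(\<lambda>n. mu n powr - \<alpha> * (graph_integral ?I (\<psi> n))\<^sup>2) sums frac_torsional_rigidity ?I mu \<psi> \<alpha>"
    by (rule frac_torsional_rigidity_sums[OF compact_interval_graph[OF L] connected_interval_graph _ B \<alpha>]) simp
  ultimately have "frac_torsional_rigidity ?I mu \<psi> \<alpha>
      = 2 / L * (pi / (2 * L)) powr - ?p * ((1 - 2 powr - ?p) * zeta_series ?p)"
    using sums_unique2 by fastforce
  \<comment> \<open>The factor 8 is 2 from the normalisation \<open>2 / L\<close> of the sines times
    4 from \<open>2 powr ?p\<close>; dividing by \<open>L\<close> lowers the exponent of
    \<open>L\<close> by one.\<close>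
  also have "2 / L * (pi / (2 * L)) powr - ?p = 8 * 2 powr (2 * \<alpha>) * L powr (2 * \<alpha> + 1) / pi powr ?p"
  proof -
    have "(pi / (2 * L)) powr - ?p = (2 * L) powr ?p / pi powr ?p"
      using L by (simp only: powr_minus powr_divide) simp
    also have "(2 * L) powr ?p = 2 powr ?p * (L powr (2 * \<alpha> + 1) * L)"
      using L by (simp add: powr_mult powr_add power2_eq_square)
    also have "2 powr ?p = 4 * 2 powr (2 * \<alpha>)" by (simp add: powr_add)
    finally show ?thesis using L by simp
  qed
  finally show ?thesis by simp
qed

theorem theorem7p2:
  fixes G :: "('v, 'e) metric_graph" and \<alpha> :: real
    and lam mu :: "nat \<Rightarrow> real"
    and \<phi> :: "nat \<Rightarrow> 'e \<Rightarrow> real \<Rightarrow> real" and \<psi> :: "nat \<Rightarrow> unit \<Rightarrow> real \<Rightarrow> real"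
  assumes "compact_metric_graph G" and "connected_metric_graph G"
    and "dirichlet_verts G \<noteq> {}"
    and "0 < \<alpha>" and "\<alpha> < 1"
    and "spectral_basis G lam \<phi>"
    and "spectral_basis (interval_graph (total_length G)) mu \<psi>"
  shows "frac_torsional_rigidity G lam \<phi> \<alpha>
           \<le> frac_torsional_rigidity (interval_graph (total_length G)) mu \<psi> \<alpha> \<and>
         frac_torsional_rigidity (interval_graph (total_length G)) mu \<psi> \<alpha>
           = 8 * 2 powr (2 * \<alpha>) * total_length G powr (2 * \<alpha> + 1) / pi powr (2 + 2 * \<alpha>)
             * (1 - 2 powr - (2 + 2 * \<alpha>)) * zeta_series (2 + 2 * \<alpha>)"
proof
  let ?L = "total_length G"
  let ?I = "interval_graph ?L"
  note G = assms(1-3) and \<alpha> = assms(4,5) and B = assms(6) and B' = assms(7)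
  interpret fin_digraph "underlying G" using G(1) by (simp add: compact_metric_graph_def)
  have L: "0 < ?L"
    unfolding total_length_def
    using G(1) spectral_basis_arcs[OF B] by (intro sum_pos) (auto simp: compact_metric_graph_def)
  have I: "compact_metric_graph ?I" "connected_metric_graph ?I" "dirichlet_verts ?I \<noteq> {}"
    using compact_interval_graph[OF L] connected_interval_graph by auto
  show "frac_torsional_rigidity G lam \<phi> \<alpha> \<le> frac_torsional_rigidity ?I mu \<psi> \<alpha>"
  \<comment> \<open>The calibration bound on \<open>G\<close> and the exact resolvent sum of the
    interval are the same function of \<open>s\<close>, which plays the role of
    \<open>R\<close>.\<close>
  proof (rule powr_series_le[OF \<alpha>])
    show "0 < lam n" "0 < mu n" for n by (rule eigenvalue_pos[OF G B] eigenvalue_pos[OF I B'])+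
    show "(\<Sum>n<N. (graph_integral G (\<phi> n))\<^sup>2 / (s + lam n)) \<le> (?L - tanh (sqrt s * ?L) / sqrt s) / s"
      if "0 < s" for s N by (rule resolvent_partial_sum_le[OF G B that])
    show "(\<lambda>n. (graph_integral ?I (\<psi> n))\<^sup>2 / (s + mu n)) sums ((?L - tanh (sqrt s * ?L) / sqrt s) / s)"
      if "0 < s" for s by (rule interval_resolvent_sums[OF L that B'])
    show "(\<lambda>n. lam n powr - \<alpha> * (graph_integral G (\<phi> n))\<^sup>2) sums frac_torsional_rigidity G lam \<phi> \<alpha>"
      by (rule frac_torsional_rigidity_sums[OF G B \<alpha>(1)])
    show "(\<lambda>n. mu n powr - \<alpha> * (graph_integral ?I (\<psi> n))\<^sup>2) sums frac_torsional_rigidity ?I mu \<psi> \<alpha>"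
      by (rule frac_torsional_rigidity_sums[OF I B' \<alpha>(1)])
  qed auto
  show "frac_torsional_rigidity ?I mu \<psi> \<alpha>
           = 8 * 2 powr (2 * \<alpha>) * ?L powr (2 * \<alpha> + 1) / pi powr (2 + 2 * \<alpha>)
             * (1 - 2 powr - (2 + 2 * \<alpha>)) * zeta_series (2 + 2 * \<alpha>)"
    by (rule interval_frac_torsional_rigidity[OF L \<alpha>(1) B'])
qed

end
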